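(* Let $X$ and $Y$ be Banach spaces and let $\mathcal{K}(X,Y)$ be the space of compact operators from $X$ to $Y$ with the operator norm. Every very smooth point $T$ of $\mathcal{K}(X,Y)$ attains its norm at a unique (up to scalar multiples) unit vector $x_0 \in X$, and $T(x_0)$ is a very smooth point of $Y$.
   Context: A unit vector $x$ of a Banach space $Z$ is a smooth point of $Z$ if there is exactly one $z^* \in Z^*$ with $\|z^*\| = 1 = z^*(x)$. A unit vector $x \in Z$ is a very smooth point of $Z$ if, regarded as an element of $Z^{**}$ under the canonical embedding $Z \subset Z^{**}$, it is a smooth point of $Z^{**}$. $T$ attains its norm at a unit vector $x_0$ if $\|T(x_0)\| = \|T\|$. *)

theory Defs
  imports "HOL-Analysis.Analysis" "HOL-Library.Function_Algebras"
begin

text \<open>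
  Scalar fields are types of sort \<open>{real_normed_field, euclidean_space}\<close>. Both \<open>real\<close> and
  \<open>complex\<close> have this sort, and by the Frobenius theorem a finite-dimensional commutative
  real division algebra is isomorphic to one of them, so the sort covers exactly the two
  classical scalar fields. A Banach space over \<open>'k\<close> is a type of class \<open>banach\<close> together with
  a multiplication by scalars from \<open>'k\<close> that extends \<open>scaleR\<close> and is compatible with the norm.
\<close>

locale normed_space_over = vector_space scale
  for scale :: "'k::{real_normed_field,euclidean_space} \<Rightarrow> 'a::real_normed_vector \<Rightarrow> 'a" +
  assumes norm_scale: "norm (scale c x) = norm c * norm x"
    and scale_of_real: "scale (of_real r) x = r *\<^sub>R x"

lemma normed_space_over_real:
  "normed_space_over ((*\<^sub>R) :: real \<Rightarrow> 'a::real_normed_vector \<Rightarrow> 'a)"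
  by unfold_locales (simp_all add: scaleR_add_right scaleR_add_left)

lemma normed_space_over_complex: "normed_space_over ((*) :: complex \<Rightarrow> complex \<Rightarrow> complex)"
  by unfold_locales (simp_all add: algebra_simps norm_mult scaleR_conv_of_real)

text \<open>
  The space of compact operators and the iterated duals depend on the scalar multiplications,
  which are terms, so they cannot be types. They are given by a carrier set, a scalar
  multiplication and a norm; the addition is that of the ambient type, which is pointwise
  for functions.
\<close>

record ('k, 'v) nspace =
  vectors :: "'v set"
  smul :: "'k \<Rightarrow> 'v \<Rightarrow> 'v"
  nnorm :: "'v \<Rightarrow> real"

definition whole_space :: "('k \<Rightarrow> 'a \<Rightarrow> 'a) \<Rightarrow> ('k, 'a::real_normed_vector) nspace" where
  "whole_space s = \<lparr>vectors = UNIV, smul = s, nnorm = norm\<rparr>"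

definition compact_operators ::
  "('k::field \<Rightarrow> 'a::real_normed_vector \<Rightarrow> 'a) \<Rightarrow> ('k \<Rightarrow> 'b::real_normed_vector \<Rightarrow> 'b)
    \<Rightarrow> ('k, 'a \<Rightarrow> 'b) nspace" where
  "compact_operators sX sY =
    \<lparr>vectors = {T. Vector_Spaces.linear sX sY T \<and> compact (closure (T ` cball 0 1))},
     smul = (\<lambda>c T x. sY c (T x)),
     nnorm = onorm\<rparr>"

text \<open>
  Functionals are defined on the whole ambient type; they are required to vanish outside the
  carrier, so that functionals which agree on the space are equal.
\<close>

definition dual :: "('k::real_normed_field, 'v::ab_group_add) nspace \<Rightarrow> ('k, 'v \<Rightarrow> 'k) nspace" where
  "dual Z =
    \<lparr>vectors = {f. (\<forall>x\<in>vectors Z. \<forall>y\<in>vectors Z. f (x + y) = f x + f y) \<and>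
                   (\<forall>c. \<forall>x\<in>vectors Z. f (smul Z c x) = c * f x) \<and>
                   (\<exists>B. \<forall>x\<in>vectors Z. norm (f x) \<le> B * nnorm Z x) \<and>
                   (\<forall>x. x \<notin> vectors Z \<longrightarrow> f x = 0)},
     smul = (\<lambda>c f x. c * f x),
     nnorm = (\<lambda>f. SUP x\<in>{x \<in> vectors Z. nnorm Z x \<le> 1}. norm (f x))\<rparr>"

definition canonical_embedding ::
  "('k::real_normed_field, 'v::ab_group_add) nspace \<Rightarrow> 'v \<Rightarrow> ('v \<Rightarrow> 'k) \<Rightarrow> 'k" where
  "canonical_embedding Z x = (\<lambda>f. if f \<in> vectors (dual Z) then f x else 0)"

definition smooth_point :: "('k::real_normed_field, 'v::ab_group_add) nspace \<Rightarrow> 'v \<Rightarrow> bool" where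
  "smooth_point Z x \<longleftrightarrow>
    x \<in> vectors Z \<and> nnorm Z x = 1 \<and>
    (\<exists>!f. f \<in> vectors (dual Z) \<and> nnorm (dual Z) f = 1 \<and> f x = 1)"

definition very_smooth_point :: "('k::real_normed_field, 'v::ab_group_add) nspace \<Rightarrow> 'v \<Rightarrow> bool" where
  "very_smooth_point Z x \<longleftrightarrow>
    x \<in> vectors Z \<and> nnorm Z x = 1 \<and>
    smooth_point (dual (dual Z)) (canonical_embedding Z x)"

definition attains_norm_at :: "('a::real_normed_vector \<Rightarrow> 'b::real_normed_vector) \<Rightarrow> 'a \<Rightarrow> bool" where
  "attains_norm_at T x \<longleftrightarrow> norm x = 1 \<and> norm (T x) = onorm T"

end

theory Submission
  imports Defs
begin

text \<open>
  Write \<open>K\<close> for the space of compact operators from \<open>X\<close> to \<open>Y\<close>, and \<open>x \<otimes> g\<close> for the functional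
  \<open>S \<mapsto> g (S x)\<close> on \<open>K\<close>, where \<open>x \<in> X\<close> and \<open>g \<in> Y\<^sup>*\<close>. The heart of the matter is that the functional that norms \<open>T\<close>
  is of this form, and everything follows from that.

  Very smoothness enters as a localisation principle (\<open>norming_functional_in_closure\<close>): if a subspace
  \<open>D\<close> of \<open>Z\<^sup>*\<close> contains functionals of norm at most 1 that almost norm the very smooth point \<open>x\<close>, then
  the functional \<open>z\<close> that norms \<open>x\<close> lies in the norm closure of \<open>D\<close>. Indeed the seminorm
  \<open>p H = sup {\<bar>H d\<bar> : d \<in> D, \<parallel>d\<parallel> \<le> 1}\<close> on \<open>Z\<^sup>*\<^sup>*\<close> takes the value 1 at \<open>x\<close>, so that by Hahn-Banach some
  functional on \<open>Z\<^sup>*\<^sup>*\<close> dominated by \<open>p\<close> norms \<open>x\<close>. By uniqueness it is evaluation at \<open>z\<close>, whence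
  \<open>\<bar>H z\<bar> \<le> p H\<close> for all \<open>H\<close>. An \<open>H\<close> that vanishes on \<open>D\<close> therefore vanishes at \<open>z\<close>, and a second use of
  Hahn-Banach puts \<open>z\<close> into the closure of \<open>D\<close>.

  Since \<open>T\<close> is compact, the closure of the image of the unit ball contains a vector \<open>y\<close> of maximal norm
  \<open>\<parallel>T\<parallel> = 1\<close>. If \<open>g\<close> norms \<open>y\<close>, then the functionals \<open>x \<otimes> g\<close> with \<open>\<parallel>x\<parallel> \<le> 1\<close> almost norm \<open>T\<close>, so \<open>z\<close> is in
  the closure of \<open>D = {x \<otimes> g : x \<in> X}\<close>. The map \<open>x \<mapsto> x \<otimes> g\<close> is isometric and \<open>X\<close> is complete; thus
  \<open>D\<close> is closed and \<open>z = x0 \<otimes> g\<close>. Now \<open>g (T x0) = 1\<close> shows that \<open>T\<close> attains its norm at \<open>x0\<close>. If \<open>T\<close> also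
  attains its norm at \<open>x\<close>, and \<open>h\<close> norms \<open>T x\<close>, then \<open>x \<otimes> h\<close> norms \<open>T\<close> too; so \<open>x \<otimes> h = x0 \<otimes> g\<close>, and
  evaluation at rank one operators shows that \<open>x\<close> and \<open>x0\<close> are proportional. Finally \<open>S \<mapsto> S x0\<close> is a
  contraction of \<open>K\<close> onto \<open>Y\<close> with a contractive right inverse whose values are rank one operators, and
  such a map sends a very smooth point to a very smooth point as long as the norm of the image is 1
  (\<open>very_smooth_point_image\<close>).

  The Hahn-Banach theorem is proved for an abstract scalar field. The real version comes from
  minimal sublinear functionals; the passage to scalars in \<open>'k\<close> uses that every real linear
  functional on \<open>'k\<close> has the form \<open>b \<mapsto> inner (a * b) 1\<close>.
\<close>

section \<open>Minimal sublinear functionals and the real Hahn-Banach theorem\<close>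

locale linear_subspace = vector_space s
  for s :: "'k::{real_normed_field,euclidean_space} \<Rightarrow> 'v::ab_group_add \<Rightarrow> 'v" +
  fixes V :: "'v set"
  assumes subspace_V: "subspace V"
begin

lemma zero_mem [simp]: "0 \<in> V" and add_mem [simp]: "x \<in> V \<Longrightarrow> y \<in> V \<Longrightarrow> x + y \<in> V"
  and scale_mem [simp]: "x \<in> V \<Longrightarrow> s c x \<in> V"
  and minus_mem [simp]: "x \<in> V \<Longrightarrow> - x \<in> V"
  and diff_mem [simp]: "x \<in> V \<Longrightarrow> y \<in> V \<Longrightarrow> x - y \<in> V"
  using subspace_V by (auto intro: subspace_0 subspace_add subspace_scale subspace_neg subspace_diff)

text \<open>
  Sublinear functionals live on the carrier \<open>V\<close> but are total functions. The value 0 outside \<open>V\<close> makes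
  the pointwise order on functions agree with the order on \<open>V\<close>, which gives antisymmetry.
\<close>
definition sublinear :: "('v \<Rightarrow> real) \<Rightarrow> bool" where
  "sublinear q \<longleftrightarrow> (\<forall>x\<in>V. \<forall>y\<in>V. q (x + y) \<le> q x + q y) \<and>
     (\<forall>x\<in>V. \<forall>t\<ge>0. q (s (of_real t) x) \<le> t * q x) \<and> (\<forall>x. x \<notin> V \<longrightarrow> q x = 0)"

lemma sublinear_add: "sublinear q \<Longrightarrow> x \<in> V \<Longrightarrow> y \<in> V \<Longrightarrow> q (x + y) \<le> q x + q y"
  and sublinear_scale_le: "sublinear q \<Longrightarrow> x \<in> V \<Longrightarrow> t \<ge> 0 \<Longrightarrow> q (s (of_real t) x) \<le> t * q x"
  and sublinear_outside: "sublinear q \<Longrightarrow> x \<notin> V \<Longrightarrow> q x = 0"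
  by (auto simp: sublinear_def)

lemma sublinear_zero:
  assumes "sublinear q" shows "q 0 = 0"
  using sublinear_add[OF assms, of 0 0] sublinear_scale_le[OF assms, of 0 0] by simp

lemma sublinear_scale:
  assumes "sublinear q" "x \<in> V" "t \<ge> 0"
  shows "q (s (of_real t) x) = t * q x"
proof (cases "t = 0")
  case True
  then show ?thesis using sublinear_zero[OF assms(1)] by simp
next
  case False
  then have t: "t > 0" using assms by simp
  have "q (s (of_real (1/t)) (s (of_real t) x)) \<le> (1/t) * q (s (of_real t) x)"
    using assms t by (intro sublinear_scale_le) auto
  moreover have "s (of_real (1/t)) (s (of_real t) x) = x" using t
    by (metis False divide_self_if of_real_1 of_real_mult scale_one scale_scale times_divide_eq_left mult_1)
  ultimately have "t * q x \<le> q (s (of_real t) x)" using t by (simp add: field_simps)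
  then show ?thesis using sublinear_scale_le[OF assms] by simp
qed

lemma sublinear_lower:
  assumes "sublinear q" "x \<in> V" shows "- q (- x) \<le> q x"
  using sublinear_add[OF assms, of "- x"] sublinear_zero[OF assms(1)] assms by simp

text \<open>
  For sublinear \<open>q\<close>, this is the largest sublinear functional below \<open>q\<close> whose value at \<open>- y\<close> is at most \<open>- q y\<close>. A linear
  functional below it agrees with \<open>q\<close> at \<open>y\<close>.
\<close>
definition tilt :: "('v \<Rightarrow> real) \<Rightarrow> 'v \<Rightarrow> 'v \<Rightarrow> real" where
  "tilt q y x = (if x \<in> V then INF t\<in>{0..}. q (x + s (of_real t) y) - t * q y else 0)"

lemma tilt_le:
  assumes q: "sublinear q" and "x \<in> V" "y \<in> V" "t \<ge> 0"
  shows "tilt q y x \<le> q (x + s (of_real t) y) - t * q y"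
proof -
  have "bdd_below ((\<lambda>t. q (x + s (of_real t) y) - t * q y) ` {0..})"
  proof (rule bdd_belowI2)
    fix t :: real assume "t \<in> {0..}"
    then have t: "t \<ge> 0" by simp
    have "q (s (of_real t) y) \<le> q (x + s (of_real t) y) + q (- x)"
      using sublinear_add[OF q, of "x + s (of_real t) y" "- x"] assms by simp
    then show "- q (- x) \<le> q (x + s (of_real t) y) - t * q y"
      using sublinear_scale[OF q \<open>y \<in> V\<close> t] by simp
  qed
  then show ?thesis using assms by (auto simp: tilt_def intro: cINF_lower2)
qed

lemma le_tilt:
  assumes "x \<in> V" "\<And>t. t \<ge> 0 \<Longrightarrow> r \<le> q (x + s (of_real t) y) - t * q y"
  shows "r \<le> tilt q y x"
  using assms by (auto simp: tilt_def intro: cINF_greatest)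

lemma sublinear_tilt:
  assumes q: "sublinear q" and y: "y \<in> V"
  shows "sublinear (tilt q y)"
  unfolding sublinear_def
proof (intro conjI ballI allI impI)
  fix x x' assume x: "x \<in> V" "x' \<in> V"
  have "tilt q y (x + x') \<le> (q (x + s (of_real t) y) - t * q y) + (q (x' + s (of_real t') y) - t' * q y)"
    if "t \<ge> 0" "t' \<ge> 0" for t t'
  proof -
    have "tilt q y (x + x') \<le> q (x + x' + s (of_real (t + t')) y) - (t + t') * q y"
      using that x y by (intro tilt_le q) auto
    also have "x + x' + s (of_real (t + t')) y = (x + s (of_real t) y) + (x' + s (of_real t') y)"
      by (simp add: scale_left_distrib algebra_simps)
    finally show ?thesis
      using sublinear_add[OF q, of "x + s (of_real t) y" "x' + s (of_real t') y"] x y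
      by (simp add: algebra_simps)
  qed
  then have "tilt q y (x + x') - (q (x + s (of_real t) y) - t * q y) \<le> tilt q y x'" if "t \<ge> 0" for t
    using that x(2) by (intro le_tilt) (simp_all add: diff_le_eq add.commute)
  then have "tilt q y (x + x') - tilt q y x' \<le> q (x + s (of_real t) y) - t * q y" if "t \<ge> 0" for t
    using that by (smt (verit))
  then have "tilt q y (x + x') - tilt q y x' \<le> tilt q y x"
    by (rule le_tilt[OF x(1)])
  then show "tilt q y (x + x') \<le> tilt q y x + tilt q y x'" by simp
next
  fix x and c :: real assume x: "x \<in> V" and c: "c \<ge> 0"
  show "tilt q y (s (of_real c) x) \<le> c * tilt q y x"
  proof (cases "c = 0")
    case True
    then show ?thesis using tilt_le[OF q zero_mem y, of 0] sublinear_zero[OF q] by simp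
  next
    case False
    have "tilt q y (s (of_real c) x) / c \<le> q (x + s (of_real t) y) - t * q y" if t: "t \<ge> 0" for t
    proof -
      have "tilt q y (s (of_real c) x) \<le> q (s (of_real c) x + s (of_real (c * t)) y) - c * t * q y"
        using x y t c by (intro tilt_le q) auto
      also have "s (of_real c) x + s (of_real (c * t)) y = s (of_real c) (x + s (of_real t) y)"
        by (simp add: scale_right_distrib)
      also have "q \<dots> = c * q (x + s (of_real t) y)"
        using x y c by (intro sublinear_scale q) auto
      finally show ?thesis using False c by (simp add: field_simps)
    qed
    then have "tilt q y (s (of_real c) x) / c \<le> tilt q y x" using x by (intro le_tilt)
    then show ?thesis using False c by (simp add: field_simps)
  qed
qed (simp add: tilt_def)

lemma tilt_le_self:
  assumes "sublinear q" "y \<in> V" shows "tilt q y \<le> q"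
proof (rule le_funI)
  fix x show "tilt q y x \<le> q x"
    using tilt_le[OF assms(1) _ assms(2), of x 0] sublinear_outside[OF assms(1), of x]
    by (cases "x \<in> V") (auto simp: tilt_def)
qed

text \<open>
  Zorn's lemma applies because the pointwise infimum of a chain is again sublinear: it is finite, as
  \<open>- p (- x)\<close> is a common lower bound, and for subadditivity two members of the chain may be
  replaced by the smaller one.
\<close>
lemma minimal_sublinear_below:
  assumes p: "sublinear p"
  obtains q where "sublinear q" "q \<le> p" "\<And>q'. sublinear q' \<Longrightarrow> q' \<le> q \<Longrightarrow> q' = q"
proof -
  define A where "A = {q. sublinear q \<and> q \<le> p}"
  define P :: "('v \<Rightarrow> real) \<Rightarrow> _" where "P = (\<lambda>a b. b \<le> a)"
  have "\<exists>m\<in>A. \<forall>a\<in>A. P m a \<longrightarrow> a = m"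
  proof (rule predicate_Zorn)
    show "partial_order_on A (relation_of P A)"
      by (rule partial_order_on_relation_ofI) (auto simp: P_def)
  next
    fix C assume C: "C \<in> Chains (relation_of P A)"
    then have CA: "C \<subseteq> A" and tot: "\<And>a b. a \<in> C \<Longrightarrow> b \<in> C \<Longrightarrow> a \<le> b \<or> b \<le> a"
      by (auto simp: Chains_def relation_of_def P_def)
    show "\<exists>u\<in>A. \<forall>a\<in>C. P a u"
    proof (cases "C = {}")
      case True
      then show ?thesis using p by (auto simp: A_def)
    next
      case False
      define u where "u x = (INF a\<in>C. a x)" for x
      have bdd: "bdd_below ((\<lambda>a. a x) ` C)" for x
      proof (rule bdd_belowI2)
        fix a assume "a \<in> C"
        then have a: "sublinear a" "a \<le> p" using CA by (auto simp: A_def)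
        then show "(if x \<in> V then - p (- x) else 0) \<le> a x"
          using sublinear_lower[OF a(1), of x] sublinear_outside[OF a(1), of x] le_funD[OF a(2), of "- x"]
          by auto
      qed
      have le: "u x \<le> a x" if "a \<in> C" for a x
        unfolding u_def using bdd that by (rule cINF_lower)
      have ge: "r \<le> u x" if "\<And>a. a \<in> C \<Longrightarrow> r \<le> a x" for r x
        unfolding u_def using False that by (rule cINF_greatest)
      have "sublinear u"
        unfolding sublinear_def
      proof (intro conjI ballI allI impI)
        fix x y assume xy: "x \<in> V" "y \<in> V"
        have *: "u (x + y) \<le> a x + b y" if ab: "a \<in> C" "b \<in> C" for a b
        proof -
          obtain c where c: "c \<in> C" "c \<le> a" "c \<le> b" using tot[OF ab] ab by auto
          have "u (x + y) \<le> c x + c y"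
            using le[OF c(1), of "x + y"] sublinear_add[of c x y] c CA xy by (auto simp: A_def)
          then show ?thesis using le_funD[OF c(2), of x] le_funD[OF c(3), of y] by simp
        qed
        have "u (x + y) - a x \<le> u y" if "a \<in> C" for a
        proof (rule ge)
          fix b assume "b \<in> C"
          with \<open>a \<in> C\<close> have "u (x + y) \<le> a x + b y" by (rule *)
          then show "u (x + y) - a x \<le> b y" by simp
        qed
        then have "u (x + y) - u y \<le> u x" by (intro ge) (simp add: diff_le_eq le_diff_eq add.commute)
        then show "u (x + y) \<le> u x + u y" by simp
      next
        fix x and t :: real assume x: "x \<in> V" and t: "t \<ge> 0"
        have *: "u (s (of_real t) x) \<le> t * a x" if "a \<in> C" for a
          using le[OF that, of "s (of_real t) x"] sublinear_scale_le[of a x t] CA that x t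
          by (auto simp: A_def)
        show "u (s (of_real t) x) \<le> t * u x"
        proof (cases "t = 0")
          case True
          then show ?thesis using * False by auto
        next
          case nz: False
          then have "u (s (of_real t) x) / t \<le> u x"
            using * t by (intro ge) (auto simp: field_simps)
          then show ?thesis using nz t by (simp add: field_simps)
        qed
      next
        fix x assume "x \<notin> V"
        then have "a x = 0" if "a \<in> C" for a using that CA by (auto simp: A_def sublinear_outside)
        then have "(\<lambda>a. a x) ` C = (\<lambda>a. 0) ` C" by (intro image_cong) auto
        then have "(\<lambda>a. a x) ` C = {0}" using False by (simp add: image_constant_conv)
        then show "u x = 0" unfolding u_def by simp
      qed
      moreover have "u \<le> p"
      proof -
        obtain a where "a \<in> C" using False by auto
        then have "a \<le> p" "u \<le> a" using CA le by (auto simp: A_def le_fun_def)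
        then show ?thesis by simp
      qed
      ultimately show ?thesis using le by (intro bexI[of _ u]) (auto simp: A_def P_def le_fun_def)
    qed
  qed
  then obtain q where "q \<in> A" "\<And>a. a \<in> A \<Longrightarrow> a \<le> q \<Longrightarrow> a = q" by (auto simp: P_def)
  then show ?thesis using that[of q] by (auto simp: A_def)
qed

text \<open>
  Tilting a minimal functional cannot change it. Sublinear functionals that are odd are additive, so
  this makes minimal functionals linear.
\<close>
lemma minimal_sublinear_odd:
  assumes q: "sublinear q" and min: "\<And>q'. sublinear q' \<Longrightarrow> q' \<le> q \<Longrightarrow> q' = q" and y: "y \<in> V"
  shows "q (- y) = - q y"
proof -
  have "tilt q y = q" using q y by (intro min sublinear_tilt tilt_le_self)
  then have "q (- y) \<le> q (- y + s (of_real 1) y) - 1 * q y"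
    using tilt_le[OF q _ y, of "- y" 1] y by simp
  then show ?thesis using sublinear_zero[OF q] sublinear_lower[OF q y] by simp
qed

text \<open>
  A minimal functional below the tilt of \<open>p\<close> at \<open>x0\<close> is linear; it lies below \<open>p\<close>, and the tilt forces
  its value at \<open>- x0\<close> down to \<open>- p x0\<close>.
\<close>
theorem real_hahn_banach:
  assumes p: "sublinear p" and x0: "x0 \<in> V"
  obtains r where "\<And>x y. x \<in> V \<Longrightarrow> y \<in> V \<Longrightarrow> r (x + y) = r x + r y"
    "\<And>t x. x \<in> V \<Longrightarrow> r (s (of_real t) x) = t * r x"
    "\<And>x. r x \<le> p x" "r x0 = p x0"
proof -
  obtain r where r: "sublinear r" "r \<le> tilt p x0"
    and min: "\<And>q'. sublinear q' \<Longrightarrow> q' \<le> r \<Longrightarrow> q' = r"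
    using minimal_sublinear_below[OF sublinear_tilt[OF p x0]] by blast
  have odd: "r (- x) = - r x" if "x \<in> V" for x
    using r(1) min that by (rule minimal_sublinear_odd)
  have le: "r x \<le> p x" for x
    using r(2) tilt_le_self[OF p x0] by (meson le_funD order_trans)
  show ?thesis
  proof
    fix x y assume xy: "x \<in> V" "y \<in> V"
    have "r (- (x + y)) \<le> r (- x) + r (- y)"
      using sublinear_add[OF r(1), of "- x" "- y"] xy by simp
    then show "r (x + y) = r x + r y"
      using odd[of x] odd[of y] odd[of "x + y"] sublinear_add[OF r(1) xy] xy by simp
  next
    fix x t assume x: "x \<in> V"
    show "r (s (of_real t) x) = t * r x"
    proof (cases "t \<ge> 0")
      case True
      then show ?thesis using sublinear_scale[OF r(1) x] by simp
    next
      case False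
      then have "r (s (of_real (- t)) x) = - t * r x" by (intro sublinear_scale r(1) x) simp
      then show ?thesis using odd[of "s (of_real t) x"] x by simp
    qed
  next
    have "r (- x0) \<le> p (- x0 + s (of_real 1) x0) - 1 * p x0"
      using le_funD[OF r(2), of "- x0"] tilt_le[OF p _ x0, of "- x0" 1] x0 by simp
    then show "r x0 = p x0"
      using odd[OF x0] le[of x0] sublinear_zero[OF p] by simp
  qed (rule le)
qed

end

section \<open>The Hahn-Banach theorem over the scalar field\<close>

locale seminorm_on = linear_subspace s V
  for s :: "'k::{real_normed_field,euclidean_space} \<Rightarrow> 'v::ab_group_add \<Rightarrow> 'v" and V +
  fixes p :: "'v \<Rightarrow> real"
  assumes triangle: "x \<in> V \<Longrightarrow> y \<in> V \<Longrightarrow> p (x + y) \<le> p x + p y"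
    and homogeneous: "x \<in> V \<Longrightarrow> p (s c x) = norm c * p x"
begin

lemma minus: "x \<in> V \<Longrightarrow> p (- x) = p x"
  using homogeneous[of x "- 1"] by simp

lemma zero [simp]: "p 0 = 0"
  using homogeneous[of 0 0] by simp

lemma nonneg: "x \<in> V \<Longrightarrow> 0 \<le> p x"
  using triangle[of x "- x"] minus[of x] by simp

end

lemma inner_of_real_one: "inner (of_real r :: 'k::{real_normed_field,euclidean_space}) 1 = r"
  by (simp add: of_real_def dot_square_norm)

text \<open>
  The bilinear form \<open>inner (a * b) 1\<close> is nondegenerate, as its value is 1 if \<open>b\<close> is the inverse of \<open>a\<close>. In
  finite dimension it therefore represents every real linear functional. Over the complex numbers
  the form is the real part of \<open>a * b\<close>.
\<close>
lemma trace_form_representation: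
  fixes h :: "'k::{real_normed_field,euclidean_space} \<Rightarrow> real"
  assumes "linear h"
  shows "\<exists>a. \<forall>b. inner (a * b) 1 = h b"
proof -
  \<comment> \<open>\<open>L a\<close> is the vector that represents the functional of \<open>a\<close> in the inner product.\<close>
  define L :: "'k \<Rightarrow> 'k" where "L a = (\<Sum>e\<in>Basis. inner (a * e) 1 *\<^sub>R e)" for a
  have L: "linear L"
    by (rule linearI) (simp_all add: L_def algebra_simps inner_simps sum.distrib scaleR_sum_right)
  have rep: "inner (L a) b = inner (a * b) 1" for a b
  proof -
    have "inner (a * b) 1 = inner (a * (\<Sum>e\<in>Basis. inner b e *\<^sub>R e)) 1"
      by (simp add: euclidean_representation)
    also have "\<dots> = (\<Sum>e\<in>Basis. inner b e * inner (a * e) 1)"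
      by (simp add: sum_distrib_left inner_sum_left)
    also have "\<dots> = inner (L a) b"
      by (simp add: L_def inner_sum_left mult.commute inner_commute[of b])
    finally show ?thesis by simp
  qed
  have "inj L"
  proof (rule linear_injective_0[OF L, THEN iffD2], intro allI impI, rule ccontr)
    fix a assume "L a = 0" "a \<noteq> 0"
    then show False using rep[of a "inverse a"] by (simp add: dot_square_norm)
  qed
  then have "surj L" using L linear_injective_imp_surjective by blast
  then obtain a where a: "L a = (\<Sum>e\<in>Basis. h e *\<^sub>R e)" by (metis surjD)
  have "inner (a * b) 1 = h b" for b
  proof -
    have "h b = h (\<Sum>e\<in>Basis. inner b e *\<^sub>R e)" by (simp add: euclidean_representation)
    also have "\<dots> = (\<Sum>e\<in>Basis. inner b e * h e)"
      by (simp add: linear_sum[OF assms] linear_cmul[OF assms])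
    also have "\<dots> = inner (L a) b" by (simp add: a inner_sum_left mult.commute inner_commute[of b])
    finally show ?thesis by (simp add: rep)
  qed
  then show ?thesis by blast
qed

lemma trace_form_cancel:
  fixes a a' :: "'k::{real_normed_field,euclidean_space}"
  assumes "\<And>b. inner (a * b) 1 = inner (a' * b) 1"
  shows "a = a'"
proof (rule ccontr)
  assume "a \<noteq> a'"
  moreover have "inner ((a - a') * inverse (a - a')) 1 = 0"
    by (subst left_diff_distrib) (simp add: inner_diff_left assms)
  ultimately show False by (simp add: dot_square_norm)
qed

text \<open>
  The classical reduction of the complex case to the real one recovers a functional from its real
  part. Here \<open>f x\<close> is the scalar that represents the real linear functional \<open>b \<mapsto> r (s b x)\<close> in the
  form \<open>inner (a * b) 1\<close>; uniqueness of this scalar makes \<open>f\<close> linear over \<open>'k\<close>.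
\<close>
theorem (in seminorm_on) hahn_banach:
  assumes x0: "x0 \<in> V"
  obtains f :: "'v \<Rightarrow> 'k" where "\<And>x y. x \<in> V \<Longrightarrow> y \<in> V \<Longrightarrow> f (x + y) = f x + f y"
    "\<And>c x. x \<in> V \<Longrightarrow> f (s c x) = c * f x"
    "\<And>x. x \<in> V \<Longrightarrow> norm (f x) \<le> p x" "f x0 = of_real (p x0)" "\<And>x. x \<notin> V \<Longrightarrow> f x = 0"
proof -
  have "sublinear (\<lambda>x. if x \<in> V then p x else 0)"
    by (auto simp: sublinear_def triangle homogeneous)
  from real_hahn_banach[OF this x0] obtain r :: "'v \<Rightarrow> real"
    where r: "\<And>x y. x \<in> V \<Longrightarrow> y \<in> V \<Longrightarrow> r (x + y) = r x + r y"
      "\<And>t x. x \<in> V \<Longrightarrow> r (s (of_real t) x) = t * r x"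
      "\<And>x. x \<in> V \<Longrightarrow> r x \<le> p x" "r x0 = p x0"
    using x0 by (smt (verit, best))
  have "linear (\<lambda>b. r (s b x))" if "x \<in> V" for x
  proof (rule linearI)
    show "r (s (b + b') x) = r (s b x) + r (s b' x)" for b b'
      using that by (simp add: scale_left_distrib r)
    show "r (s (t *\<^sub>R b) x) = t *\<^sub>R r (s b x)" for t b
      using that r(2)[of "s b x" t] by (simp add: scaleR_conv_of_real)
  qed
  then have "\<forall>x\<in>V. \<exists>a. \<forall>b. inner (a * b) 1 = r (s b x)"
    using trace_form_representation by blast
  then obtain g where g: "\<And>x b. x \<in> V \<Longrightarrow> inner (g x * b) 1 = r (s b x)" by metis
  define f where "f x = (if x \<in> V then g x else 0)" for x
  have f: "inner (f x * b) 1 = r (s b x)" if "x \<in> V" for x b using that g by (simp add: f_def)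
  have bound: "norm (f x) \<le> p x" if x: "x \<in> V" for x
  proof (cases "f x = 0")
    case True
    then show ?thesis using nonneg[OF x] by simp
  next
    case False
    \<comment> \<open>Multiplication by the unimodular scalar \<open>b\<close> rotates \<open>f x\<close> onto the positive real axis.\<close>
    define b where "b = of_real (norm (f x)) / f x"
    have b: "norm b = 1" using False by (simp add: b_def norm_divide)
    have "norm (f x) = inner (f x * b) 1"
      using False by (simp add: b_def inner_of_real_one)
    also have "\<dots> = r (s b x)" using f[OF x] .
    also have "\<dots> \<le> p (s b x)" using r(3) x by simp
    also have "\<dots> = p x" using homogeneous[OF x, of b] b by simp
    finally show ?thesis .
  qed
  show ?thesis
  proof
    show "f (x + y) = f x + f y" if "x \<in> V" "y \<in> V" for x y
      by (rule trace_form_cancel)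
        (use that in \<open>simp add: f r scale_right_distrib distrib_right inner_add_left\<close>)
    show "f (s c x) = c * f x" if "x \<in> V" for c x
    proof (rule trace_form_cancel)
      show "inner (f (s c x) * b) 1 = inner (c * f x * b) 1" for b
        using f[of "s c x" b] f[of x "b * c"] that by (simp add: ac_simps)
    qed
    show "f x0 = of_real (p x0)"
    proof -
      \<comment> \<open>The component of \<open>f x0\<close> along 1 already has length \<open>p x0\<close>, and \<open>f x0\<close> is not longer than that.\<close>
      have "inner (f x0) 1 = p x0" using f[OF x0, of 1] r(4) by simp
      moreover have "(norm (f x0 - of_real (p x0)))\<^sup>2
          = (norm (f x0))\<^sup>2 - 2 * p x0 * inner (f x0) 1 + (p x0)\<^sup>2"
        unfolding power2_norm_eq_inner of_real_def
        by (simp only: inner_diff_left inner_diff_right inner_commute[of 1])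
          (simp add: inner_commute[of 1] dot_square_norm power2_eq_square)
      ultimately have "(norm (f x0 - of_real (p x0)))\<^sup>2 = (norm (f x0))\<^sup>2 - (p x0)\<^sup>2"
        by (simp add: power2_eq_square)
      also have "\<dots> \<le> 0" using bound[OF x0] by (simp add: power_mono)
      finally show ?thesis by simp
    qed
  qed (use bound in \<open>auto simp: f_def\<close>)
qed

section \<open>Seminorms and dual spaces\<close>

text \<open>
  The reverse inequality for homogeneity follows on replacing \<open>c\<close> by its inverse.
\<close>
lemma seminorm_onI:
  assumes V: "linear_subspace s V"
    and triangle: "\<And>x y. x \<in> V \<Longrightarrow> y \<in> V \<Longrightarrow> p (x + y) \<le> p x + p y"
    and scale: "\<And>c x. x \<in> V \<Longrightarrow> p (s c x) \<le> norm c * p x"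
  shows "seminorm_on s V p"
proof -
  interpret linear_subspace s V by (rule V)
  show ?thesis
  proof
    fix x c assume x: "x \<in> V"
    show "p (s c x) = norm c * p x"
    proof (cases "c = 0")
      case True
      then show ?thesis using triangle[of 0 0] scale[of 0 0] by simp
    next
      case False
      then have "p x \<le> norm (inverse c) * p (s c x)"
        using scale[of "s c x" "inverse c"] x by simp
      then have "norm c * p x \<le> p (s c x)" using False by (simp add: norm_divide inverse_eq_divide field_simps)
      then show ?thesis using scale[OF x, of c] by simp
    qed
  qed (rule triangle)
qed

lemma vector_space_pointwise:
  assumes "vector_space s"
  shows "vector_space (\<lambda>c f x. s c (f x))"
proof -
  interpret vector_space s by (rule assms)
  show ?thesis
    by unfold_locales (auto simp: fun_eq_iff scale_right_distrib scale_left_distrib)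
qed

lemma vector_space_functionals: "vector_space (\<lambda>c (f :: 'v \<Rightarrow> 'k::field) x. c * f x)"
  by (rule vector_space_pointwise) (unfold_locales, auto simp: algebra_simps)

text \<open>
  Covers the dual norm and also suprema over smaller sets of vectors, which give seminorms that see
  only a part of the space.
\<close>
lemma seminorm_on_sup:
  fixes W :: "('v \<Rightarrow> 'k::{real_normed_field,euclidean_space}) set"
  assumes W: "linear_subspace (\<lambda>c f x. c * f x) W" and A: "A \<noteq> {}"
    and bdd: "\<And>f. f \<in> W \<Longrightarrow> bdd_above ((\<lambda>x. norm (f x)) ` A)"
  shows "seminorm_on (\<lambda>c f x. c * f x) W (\<lambda>f. SUP x\<in>A. norm (f x))"
proof (rule seminorm_onI[OF W])
  have upper: "norm (f x) \<le> (SUP x\<in>A. norm (f x))" if "f \<in> W" "x \<in> A" for f x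
    using bdd that by (auto intro: cSUP_upper)
  show "(SUP x\<in>A. norm ((f + g) x)) \<le> (SUP x\<in>A. norm (f x)) + (SUP x\<in>A. norm (g x))"
    if "f \<in> W" "g \<in> W" for f g
  proof (rule cSUP_least[OF A])
    fix x assume "x \<in> A"
    then show "norm ((f + g) x) \<le> (SUP x\<in>A. norm (f x)) + (SUP x\<in>A. norm (g x))"
      using upper[OF that(1), of x] upper[OF that(2), of x] norm_triangle_ineq[of "f x" "g x"] by simp
  qed
  show "(SUP x\<in>A. norm (c * f x)) \<le> norm c * (SUP x\<in>A. norm (f x))" if "f \<in> W" for c f
    using upper[OF that] by (intro cSUP_least[OF A]) (simp add: norm_mult mult_left_mono)
qed

lemma smul_dual [simp]: "smul (dual Z) = (\<lambda>c f x. c * f x)"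
  by (simp add: dual_def)

lemma nnorm_dual: "nnorm (dual Z) f = (SUP x\<in>{x \<in> vectors Z. nnorm Z x \<le> 1}. norm (f x))"
  by (simp add: dual_def)

lemma
  assumes "f \<in> vectors (dual Z)"
  shows dual_add: "x \<in> vectors Z \<Longrightarrow> y \<in> vectors Z \<Longrightarrow> f (x + y) = f x + f y"
    and dual_scale: "x \<in> vectors Z \<Longrightarrow> f (smul Z c x) = c * f x"
    and dual_outside: "x \<notin> vectors Z \<Longrightarrow> f x = 0"
    and dual_bounded: "\<exists>B. \<forall>x\<in>vectors Z. norm (f x) \<le> B * nnorm Z x"
  using assms by (auto simp: dual_def)

locale seminormed_nspace = seminorm_on "smul Z" "vectors Z" "nnorm Z"
  for Z :: "('k::{real_normed_field,euclidean_space}, 'v::ab_group_add) nspace"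
begin

lemma dual_bounded_on_ball:
  assumes "f \<in> vectors (dual Z)"
  shows "bdd_above ((\<lambda>x. norm (f x)) ` {x \<in> vectors Z. nnorm Z x \<le> 1})"
proof -
  obtain B where B: "\<And>x. x \<in> vectors Z \<Longrightarrow> norm (f x) \<le> B * nnorm Z x"
    using dual_bounded[OF assms] by blast
  show ?thesis
  proof (rule bdd_aboveI2)
    fix x assume x: "x \<in> {x \<in> vectors Z. nnorm Z x \<le> 1}"
    have "norm (f x) \<le> \<bar>B\<bar> * nnorm Z x"
      using B[of x] mult_right_mono[OF abs_ge_self nonneg, of x B] x by auto
    also have "\<dots> \<le> \<bar>B\<bar>" using x nonneg[of x] mult_left_mono[of "nnorm Z x" 1 "\<bar>B\<bar>"] by auto
    finally show "norm (f x) \<le> \<bar>B\<bar>" .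
  qed
qed

lemma ball_nonempty: "{x \<in> vectors Z. nnorm Z x \<le> 1} \<noteq> {}"
  using zero zero_mem by (metis (mono_tags, lifting) empty_iff mem_Collect_eq zero_le_one)

lemma dual_linear_subspace: "linear_subspace (\<lambda>c f x. c * f x) (vectors (dual Z))"
proof -
  interpret F: vector_space "\<lambda>c (f :: 'v \<Rightarrow> 'k) x. c * f x" by (rule vector_space_functionals)
  have "F.subspace (vectors (dual Z))"
  proof (rule F.subspaceI)
    show "0 \<in> vectors (dual Z)" by (auto simp: dual_def intro: exI[of _ 0])
  next
    fix f g assume fg: "f \<in> vectors (dual Z)" "g \<in> vectors (dual Z)"
    obtain B C where "\<And>x. x \<in> vectors Z \<Longrightarrow> norm (f x) \<le> B * nnorm Z x"
      "\<And>x. x \<in> vectors Z \<Longrightarrow> norm (g x) \<le> C * nnorm Z x"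
      using fg[THEN dual_bounded] by blast
    then have "\<forall>x\<in>vectors Z. norm (f x + g x) \<le> (B + C) * nnorm Z x"
      by (metis add_mono distrib_right norm_triangle_le)
    then have "\<exists>B. \<forall>x\<in>vectors Z. norm (f x + g x) \<le> B * nnorm Z x" by blast
    with fg show "f + g \<in> vectors (dual Z)" by (simp add: dual_def algebra_simps)
  next
    fix c f assume f: "f \<in> vectors (dual Z)"
    obtain B where "\<And>x. x \<in> vectors Z \<Longrightarrow> norm (f x) \<le> B * nnorm Z x"
      using dual_bounded[OF f] by blast
    then have "\<forall>x\<in>vectors Z. norm (c * f x) \<le> (norm c * B) * nnorm Z x"
      by (simp add: norm_mult mult.assoc mult_left_mono)
    then have "\<exists>B. \<forall>x\<in>vectors Z. norm (c * f x) \<le> B * nnorm Z x" by blast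
    with f show "(\<lambda>x. c * f x) \<in> vectors (dual Z)" by (simp add: dual_def algebra_simps)
  qed
  then show ?thesis by unfold_locales
qed

lemma seminormed_dual: "seminormed_nspace (dual Z)"
  unfolding seminormed_nspace_def nnorm_dual[abs_def] smul_dual
  by (intro seminorm_on_sup dual_linear_subspace ball_nonempty dual_bounded_on_ball)

lemma dual_norm_upper:
  assumes f: "f \<in> vectors (dual Z)" and x: "x \<in> vectors Z"
  shows "norm (f x) \<le> nnorm (dual Z) f * nnorm Z x"
proof (cases "nnorm Z x = 0")
  case True
  obtain B where "\<And>x. x \<in> vectors Z \<Longrightarrow> norm (f x) \<le> B * nnorm Z x"
    using dual_bounded[OF f] by blast
  then show ?thesis using True x by fastforce
next
  case False
  then have pos: "nnorm Z x > 0" using nonneg[OF x] by simp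
  let ?y = "smul Z (of_real (1 / nnorm Z x)) x"
  have "?y \<in> {x \<in> vectors Z. nnorm Z x \<le> 1}"
    using x pos by (simp add: homogeneous norm_inverse norm_divide)
  then have "norm (f ?y) \<le> nnorm (dual Z) f"
    unfolding nnorm_dual by (intro cSUP_upper dual_bounded_on_ball f)
  then show ?thesis using pos by (simp add: dual_scale[OF f x] norm_mult norm_divide field_simps)
qed

lemma dual_norm_le:
  assumes "\<And>x. x \<in> vectors Z \<Longrightarrow> norm (f x) \<le> M * nnorm Z x" "0 \<le> M"
  shows "nnorm (dual Z) f \<le> M"
  unfolding nnorm_dual
proof (rule cSUP_least[OF ball_nonempty])
  fix x assume x: "x \<in> {x \<in> vectors Z. nnorm Z x \<le> 1}"
  then show "norm (f x) \<le> M" using assms mult_left_mono[of "nnorm Z x" 1 M] by force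
qed

lemma dualI:
  assumes "\<And>x y. x \<in> vectors Z \<Longrightarrow> y \<in> vectors Z \<Longrightarrow> f (x + y) = f x + f y"
    "\<And>c x. x \<in> vectors Z \<Longrightarrow> f (smul Z c x) = c * f x"
    "\<And>x. x \<in> vectors Z \<Longrightarrow> norm (f x) \<le> M * nnorm Z x"
    "\<And>x. x \<notin> vectors Z \<Longrightarrow> f x = 0"
  shows "f \<in> vectors (dual Z)"
proof -
  have "\<exists>B. \<forall>x\<in>vectors Z. norm (f x) \<le> B * nnorm Z x" using assms(3) by blast
  then show ?thesis using assms by (simp add: dual_def)
qed

lemma dual_norm_eq_1:
  assumes "f \<in> vectors (dual Z)" "nnorm (dual Z) f \<le> 1" "x \<in> vectors Z" "nnorm Z x \<le> 1" "f x = 1"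
  shows "nnorm (dual Z) f = 1"
proof -
  interpret D: seminormed_nspace "dual Z" by (rule seminormed_dual)
  have "1 \<le> nnorm (dual Z) f * nnorm Z x" using dual_norm_upper[of f x] assms by simp
  moreover have "nnorm (dual Z) f * nnorm Z x \<le> nnorm (dual Z) f"
    using assms D.nonneg by (intro mult_left_le)
  ultimately show ?thesis using assms by simp
qed

text \<open>
  The form in which the Hahn-Banach theorem is used: the seminorm \<open>p\<close> controls where the functional
  is small, while the bound by the norm puts it into the unit ball of the dual.
\<close>
lemma dominated_functional:
  assumes p: "seminorm_on (smul Z) (vectors Z) p" and le: "\<And>x. x \<in> vectors Z \<Longrightarrow> p x \<le> nnorm Z x"
    and x: "x \<in> vectors Z"
  obtains f where "f \<in> vectors (dual Z)" "nnorm (dual Z) f \<le> 1" "f x = of_real (p x)"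
    "\<And>y. y \<in> vectors Z \<Longrightarrow> norm (f y) \<le> p y"
proof -
  interpret p: seminorm_on "smul Z" "vectors Z" p by (rule p)
  obtain f where f: "\<And>x y. x \<in> vectors Z \<Longrightarrow> y \<in> vectors Z \<Longrightarrow> f (x + y) = f x + f y"
    "\<And>c x. x \<in> vectors Z \<Longrightarrow> f (smul Z c x) = c * f x"
    "\<And>x. x \<in> vectors Z \<Longrightarrow> norm (f x) \<le> p x" "f x = of_real (p x)" "\<And>x. x \<notin> vectors Z \<Longrightarrow> f x = 0"
    using p.hahn_banach[OF x] by blast
  have b: "norm (f y) \<le> 1 * nnorm Z y" if "y \<in> vectors Z" for y
    using f(3)[OF that] le[OF that] by simp
  show ?thesis
    using f b by (intro that[of f] dualI[of f 1] dual_norm_le) auto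
qed

lemma norming_functional:
  assumes "x \<in> vectors Z"
  obtains f where "f \<in> vectors (dual Z)" "nnorm (dual Z) f \<le> 1" "f x = of_real (nnorm Z x)"
  using dominated_functional[OF seminorm_on_axioms _ assms] by blast

lemma canonical_embedding_apply:
  "f \<in> vectors (dual Z) \<Longrightarrow> canonical_embedding Z x f = f x"
  by (simp add: canonical_embedding_def)

lemma
  assumes x: "x \<in> vectors Z"
  shows canonical_embedding_mem: "canonical_embedding Z x \<in> vectors (dual (dual Z))"
    and canonical_embedding_norm: "nnorm (dual (dual Z)) (canonical_embedding Z x) = nnorm Z x"
proof -
  interpret D: seminormed_nspace "dual Z" by (rule seminormed_dual)
  have b: "norm (canonical_embedding Z x f) \<le> nnorm Z x * nnorm (dual Z) f" if "f \<in> vectors (dual Z)" for f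
    using dual_norm_upper[OF that x] that by (simp add: canonical_embedding_apply mult.commute)
  show mem: "canonical_embedding Z x \<in> vectors (dual (dual Z))"
    by (rule D.dualI[OF _ _ b])
      (use D.add_mem D.scale_mem in \<open>auto simp: canonical_embedding_def\<close>)
  obtain f where f: "f \<in> vectors (dual Z)" "nnorm (dual Z) f \<le> 1" "f x = of_real (nnorm Z x)"
    using norming_functional[OF x] .
  interpret DD: seminormed_nspace "dual (dual Z)" by (rule D.seminormed_dual)
  have "nnorm Z x \<le> nnorm (dual (dual Z)) (canonical_embedding Z x) * nnorm (dual Z) f"
    using D.dual_norm_upper[OF mem f(1)] f nonneg[OF x] by (simp add: canonical_embedding_apply)
  also have "\<dots> \<le> nnorm (dual (dual Z)) (canonical_embedding Z x)"
    using f DD.nonneg[OF mem] by (simp add: mult_left_le)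
  finally show "nnorm (dual (dual Z)) (canonical_embedding Z x) = nnorm Z x"
    using D.dual_norm_le[OF b nonneg[OF x]] by simp
qed

section \<open>Very smooth points\<close>

text \<open>
  Existence of a functional that norms \<open>x\<close> in the bidual is automatic by Hahn-Banach, so only
  uniqueness is at stake. The bound \<open>\<le> 1\<close> may replace norm 1 because the value at a vector of norm 1
  is already 1.
\<close>
lemma very_smooth_pointI:
  assumes x: "x \<in> vectors Z" "nnorm Z x = 1"
    and uniq: "\<And>F F'. F \<in> vectors (dual (dual (dual Z))) \<Longrightarrow> F' \<in> vectors (dual (dual (dual Z))) \<Longrightarrow>
      nnorm (dual (dual (dual Z))) F \<le> 1 \<Longrightarrow> nnorm (dual (dual (dual Z))) F' \<le> 1 \<Longrightarrow>
      F (canonical_embedding Z x) = 1 \<Longrightarrow> F' (canonical_embedding Z x) = 1 \<Longrightarrow> F = F'"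
  shows "very_smooth_point Z x"
proof -
  interpret D: seminormed_nspace "dual Z" by (rule seminormed_dual)
  interpret DD: seminormed_nspace "dual (dual Z)" by (rule D.seminormed_dual)
  have mem: "canonical_embedding Z x \<in> vectors (dual (dual Z))"
    and norm: "nnorm (dual (dual Z)) (canonical_embedding Z x) = 1"
    using x canonical_embedding_mem canonical_embedding_norm by auto
  obtain F where F: "F \<in> vectors (dual (dual (dual Z)))" "nnorm (dual (dual (dual Z))) F \<le> 1"
    "F (canonical_embedding Z x) = 1"
    using DD.norming_functional[OF mem] norm by auto
  moreover have "nnorm (dual (dual (dual Z))) F = 1"
    using F mem norm by (intro DD.dual_norm_eq_1) auto
  ultimately show ?thesis
    unfolding very_smooth_point_def smooth_point_def
    using x mem norm by (intro conjI ex1I[of _ F]) (auto intro: uniq)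
qed

context
  fixes x assumes smooth: "very_smooth_point Z x"
begin

lemma very_smooth_mem: "x \<in> vectors Z" and very_smooth_norm: "nnorm Z x = 1"
  using smooth by (auto simp: very_smooth_point_def)

lemma very_smooth_unique:
  assumes "F \<in> vectors (dual (dual (dual Z)))" "nnorm (dual (dual (dual Z))) F \<le> 1"
    "F (canonical_embedding Z x) = 1"
    and "F' \<in> vectors (dual (dual (dual Z)))" "nnorm (dual (dual (dual Z))) F' \<le> 1"
    "F' (canonical_embedding Z x) = 1"
  shows "F = F'"
proof -
  interpret D: seminormed_nspace "dual Z" by (rule seminormed_dual)
  interpret DD: seminormed_nspace "dual (dual Z)" by (rule D.seminormed_dual)
  have x: "canonical_embedding Z x \<in> vectors (dual (dual Z))"
    "nnorm (dual (dual Z)) (canonical_embedding Z x) = 1"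
    and "\<exists>!f. f \<in> vectors (dual (dual (dual Z))) \<and> nnorm (dual (dual (dual Z))) f = 1
      \<and> f (canonical_embedding Z x) = 1"
    using smooth by (auto simp: very_smooth_point_def smooth_point_def)
  moreover have "nnorm (dual (dual (dual Z))) F = 1" "nnorm (dual (dual (dual Z))) F' = 1"
    using assms x by (auto intro!: DD.dual_norm_eq_1)
  ultimately show ?thesis using assms by blast
qed

text \<open>
  Two functionals that norm \<open>x\<close> stay different when they are embedded into the third dual.
\<close>
lemma very_smooth_smooth:
  assumes f: "f \<in> vectors (dual Z)" "nnorm (dual Z) f \<le> 1" "f x = 1"
    and g: "g \<in> vectors (dual Z)" "nnorm (dual Z) g \<le> 1" "g x = 1"
  shows "f = g"
proof
  interpret D: seminormed_nspace "dual Z" by (rule seminormed_dual)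
  have eq: "canonical_embedding (dual Z) f = canonical_embedding (dual Z) g"
    using f g canonical_embedding_mem[OF very_smooth_mem]
    by (intro very_smooth_unique)
      (auto simp: D.canonical_embedding_mem D.canonical_embedding_norm
        D.canonical_embedding_apply canonical_embedding_apply)
  fix y show "f y = g y"
  proof (cases "y \<in> vectors Z")
    case True
    then show ?thesis using fun_cong[OF eq, of "canonical_embedding Z y"] f g
      by (simp add: canonical_embedding_mem D.canonical_embedding_apply canonical_embedding_apply)
  next
    case False
    then show ?thesis using f g by (simp add: dual_outside)
  qed
qed

text \<open>
  Uniqueness in the third dual shows that every \<open>H\<close> in the bidual satisfies \<open>norm (H z) \<le> p H\<close>, where \<open>p\<close> is
  the supremum over the unit ball of \<open>D\<close>. Since this covers the whole bidual and not just the evaluations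
  at vectors, \<open>z\<close> is approximated in norm rather than only in the weak-star topology.
\<close>
lemma norming_functional_in_closure:
  assumes D: "linear_subspace (smul (dual Z)) D" "D \<subseteq> vectors (dual Z)"
    and norming: "\<And>r. r < 1 \<Longrightarrow> \<exists>d\<in>D. nnorm (dual Z) d \<le> 1 \<and> r < norm (d x)"
    and z: "z \<in> vectors (dual Z)" "nnorm (dual Z) z \<le> 1" "z x = 1" and "\<epsilon> > 0"
  shows "\<exists>d\<in>D. nnorm (dual Z) (z - d) < \<epsilon>"
proof -
  interpret D: seminormed_nspace "dual Z" by (rule seminormed_dual)
  interpret DD: seminormed_nspace "dual (dual Z)" by (rule D.seminormed_dual)
  interpret S: linear_subspace "smul (dual Z)" D by (rule D(1))
  \<comment> \<open>\<open>q\<close> is the distance from \<open>D\<close>. A functional \<open>G\<close> dominated by \<open>q\<close> vanishes on \<open>D\<close>, and it can be chosen to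
    detect the distance of \<open>z\<close>.\<close>
  define q where "q w = (INF d\<in>D. nnorm (dual Z) (w - d))" for w
  have "D \<noteq> {}" using S.zero_mem by blast
  have diff: "w - d \<in> vectors (dual Z)" if "w \<in> vectors (dual Z)" "d \<in> D" for w d
    using that D(2) by (auto intro!: D.diff_mem)
  have q_le: "q w \<le> nnorm (dual Z) (w - d)" if "w \<in> vectors (dual Z)" "d \<in> D" for w d
    unfolding q_def
    by (rule cINF_lower[OF bdd_belowI2[of _ 0] that(2)]) (use that diff D.nonneg in auto)
  have le_q: "r \<le> q w" if "\<And>d. d \<in> D \<Longrightarrow> r \<le> nnorm (dual Z) (w - d)" for r w
    unfolding q_def using \<open>D \<noteq> {}\<close> that by (rule cINF_greatest)
  have q_seminorm: "seminorm_on (smul (dual Z)) (vectors (dual Z)) q"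
  proof (rule seminorm_onI[OF D.linear_subspace_axioms])
    fix v w assume vw: "v \<in> vectors (dual Z)" "w \<in> vectors (dual Z)"
    have "q (v + w) - nnorm (dual Z) (v - d) \<le> nnorm (dual Z) (w - e)" if de: "d \<in> D" "e \<in> D" for d e
    proof -
      have "q (v + w) \<le> nnorm (dual Z) ((v + w) - (d + e))"
        using vw de by (intro q_le D.add_mem S.add_mem)
      also have "(v + w) - (d + e) = (v - d) + (w - e)" by (simp add: algebra_simps)
      also have "nnorm (dual Z) \<dots> \<le> nnorm (dual Z) (v - d) + nnorm (dual Z) (w - e)"
        using vw de by (intro D.triangle diff)
      finally show ?thesis by linarith
    qed
    then have "q (v + w) - nnorm (dual Z) (v - d) \<le> q w" if "d \<in> D" for d
      using that by (intro le_q)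
    then have "q (v + w) - q w \<le> nnorm (dual Z) (v - d)" if "d \<in> D" for d
      using that by (smt (verit))
    then have "q (v + w) - q w \<le> q v" by (intro le_q)
    then show "q (v + w) \<le> q v + q w" by simp
  next
    fix c :: 'k and v assume v: "v \<in> vectors (dual Z)"
    show "q (smul (dual Z) c v) \<le> norm c * q v"
    proof (cases "c = 0")
      case True
      have "q 0 \<le> nnorm (dual Z) (0 - 0)" by (intro q_le) auto
      then show ?thesis using True D.scale_zero_left[of v] by (simp del: D.scale_zero_left)
    next
      case False
      have "q (smul (dual Z) c v) / norm c \<le> nnorm (dual Z) (v - d)" if d: "d \<in> D" for d
      proof -
        have "q (smul (dual Z) c v) \<le> nnorm (dual Z) (smul (dual Z) c v - smul (dual Z) c d)"
          using v d by (intro q_le D.scale_mem S.scale_mem)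
        also have "\<dots> = norm c * nnorm (dual Z) (v - d)"
          using D.homogeneous[OF diff[OF v d], of c] by (simp only: D.scale_right_diff_distrib)
        finally show ?thesis using False by (simp add: field_simps)
      qed
      then have "q (smul (dual Z) c v) / norm c \<le> q v" by (rule le_q)
      then show ?thesis using False by (simp add: field_simps)
    qed
  qed
  have q_le_norm: "q w \<le> nnorm (dual Z) w" if "w \<in> vectors (dual Z)" for w
    using q_le[OF that S.zero_mem] by simp
  obtain G where G: "G \<in> vectors (dual (dual Z))" "G z = of_real (q z)"
    "\<And>w. w \<in> vectors (dual Z) \<Longrightarrow> norm (G w) \<le> q w"
    using D.dominated_functional[OF q_seminorm q_le_norm z(1)] by blast
  \<comment> \<open>\<open>p\<close> measures elements of the bidual on the unit ball of \<open>D\<close> only, and it still gives \<open>x\<close> the value 1.\<close>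
  define A where "A = {d \<in> D. nnorm (dual Z) d \<le> 1}"
  define p where "p H = (SUP d\<in>A. norm (H d))" for H :: "('v \<Rightarrow> 'k) \<Rightarrow> 'k"
  have A0: "A \<noteq> {}"
    using S.zero_mem D.zero by (auto simp: A_def intro!: exI[of _ 0])
  have le_norm: "norm (H d) \<le> nnorm (dual (dual Z)) H"
    if "H \<in> vectors (dual (dual Z))" "d \<in> A" for H d
  proof -
    have "d \<in> vectors (dual Z)" "nnorm (dual Z) d \<le> 1" using that D(2) by (auto simp: A_def)
    then show ?thesis
      using D.dual_norm_upper[OF that(1), of d] DD.nonneg[OF that(1)]
        mult_left_mono[of "nnorm (dual Z) d" 1 "nnorm (dual (dual Z)) H"] by simp
  qed
  have bdd: "bdd_above ((\<lambda>d. norm (H d)) ` A)" if "H \<in> vectors (dual (dual Z))" for H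
    using le_norm[OF that] by (rule bdd_aboveI2)
  have p_seminorm: "seminorm_on (smul (dual (dual Z))) (vectors (dual (dual Z))) p"
    unfolding p_def[abs_def] smul_dual
    by (intro seminorm_on_sup D.dual_linear_subspace A0 bdd)
  have p_le: "p H \<le> nnorm (dual (dual Z)) H" if "H \<in> vectors (dual (dual Z))" for H
    unfolding p_def using A0 le_norm[OF that] by (rule cSUP_least)
  have emb: "canonical_embedding Z x \<in> vectors (dual (dual Z))"
    using very_smooth_mem by (rule canonical_embedding_mem)
  have p_emb: "p (canonical_embedding Z x) = 1"
  proof (rule antisym)
    show "p (canonical_embedding Z x) \<le> 1"
      using p_le[OF emb] by (simp add: canonical_embedding_norm very_smooth_mem very_smooth_norm)
    show "1 \<le> p (canonical_embedding Z x)"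
    proof (rule dense_le)
      fix r :: real assume "r < 1"
      then obtain d where d: "d \<in> D" "nnorm (dual Z) d \<le> 1" "r < norm (d x)" using norming by blast
      then have "canonical_embedding Z x d = d x" using D(2) by (auto simp: canonical_embedding_apply)
      moreover have "norm (canonical_embedding Z x d) \<le> p (canonical_embedding Z x)"
        unfolding p_def using d by (intro cSUP_upper bdd emb) (auto simp: A_def)
      ultimately show "r \<le> p (canonical_embedding Z x)" using d by simp
    qed
  qed
  obtain F where F: "F \<in> vectors (dual (dual (dual Z)))" "nnorm (dual (dual (dual Z))) F \<le> 1"
    "F (canonical_embedding Z x) = of_real (p (canonical_embedding Z x))"
    "\<And>H. H \<in> vectors (dual (dual Z)) \<Longrightarrow> norm (F H) \<le> p H"
    using DD.dominated_functional[OF p_seminorm p_le emb] by blast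
  \<comment> \<open>Both functionals norm \<open>x\<close> in the bidual; very smoothness identifies them.\<close>
  have "F = canonical_embedding (dual Z) z"
    using z F(1-3) p_emb emb by (intro very_smooth_unique)
      (auto simp: D.canonical_embedding_mem D.canonical_embedding_norm
        D.canonical_embedding_apply canonical_embedding_apply)
  then have "norm (G z) \<le> p G"
    using F(4)[OF G(1)] G(1) by (simp add: D.canonical_embedding_apply)
  also have "p G \<le> 0"
    unfolding p_def
  proof (rule cSUP_least[OF A0])
    fix d assume "d \<in> A"
    then have "d \<in> D" "d \<in> vectors (dual Z)" using D(2) by (auto simp: A_def)
    then show "norm (G d) \<le> 0" using order_trans[OF G(3) q_le, of d d] by simp
  qed
  finally have "q z = 0" using G(2) by simp
  then show ?thesis
    using \<open>\<epsilon> > 0\<close> le_q[of \<epsilon> z] by fastforce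
qed

end

end

section \<open>Adjoints and images of very smooth points\<close>

definition bounded_operator ::
  "('k::real_normed_field, 'v::ab_group_add) nspace \<Rightarrow> ('k, 'w::ab_group_add) nspace \<Rightarrow> real \<Rightarrow> ('v \<Rightarrow> 'w) \<Rightarrow> bool"
  where "bounded_operator Z W M L \<longleftrightarrow>
    (\<forall>x\<in>vectors Z. L x \<in> vectors W \<and> nnorm W (L x) \<le> M * nnorm Z x) \<and>
    (\<forall>x\<in>vectors Z. \<forall>y\<in>vectors Z. L (x + y) = L x + L y) \<and>
    (\<forall>c. \<forall>x\<in>vectors Z. L (smul Z c x) = smul W c (L x))"

text \<open>
  Functionals on a carrier are 0 outside of it, and the plain composition with \<open>L\<close> need not be.
\<close>
definition adjoint :: "('k, 'v) nspace \<Rightarrow> ('v \<Rightarrow> 'w) \<Rightarrow> ('w \<Rightarrow> 'k) \<Rightarrow> 'v \<Rightarrow> 'k::zero" where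
  "adjoint Z L h = (\<lambda>x. if x \<in> vectors Z then h (L x) else 0)"

lemma adjoint_apply [simp]: "x \<in> vectors Z \<Longrightarrow> adjoint Z L h x = h (L x)"
  by (simp add: adjoint_def)

lemma bounded_operator_adjoint:
  assumes Z: "seminormed_nspace Z" and W: "seminormed_nspace W"
    and L: "bounded_operator Z W M L" and M: "0 \<le> M"
  shows "bounded_operator (dual W) (dual Z) M (adjoint Z L)"
proof -
  interpret Z: seminormed_nspace Z by (rule Z)
  interpret W: seminormed_nspace W by (rule W)
  interpret W': seminormed_nspace "dual W" by (rule W.seminormed_dual)
  have Lmem: "L x \<in> vectors W" and Lnorm: "nnorm W (L x) \<le> M * nnorm Z x"
    and Lscale: "L (smul Z c x) = smul W c (L x)" if "x \<in> vectors Z" for x c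
    using L that by (auto simp: bounded_operator_def)
  have Ladd: "L (x + y) = L x + L y" if "x \<in> vectors Z" "y \<in> vectors Z" for x y
    using L that by (auto simp: bounded_operator_def)
  have "adjoint Z L h \<in> vectors (dual Z) \<and> nnorm (dual Z) (adjoint Z L h) \<le> M * nnorm (dual W) h"
    if h: "h \<in> vectors (dual W)" for h
  proof -
    have b: "norm (adjoint Z L h x) \<le> (M * nnorm (dual W) h) * nnorm Z x" if x: "x \<in> vectors Z" for x
    proof -
      have "norm (h (L x)) \<le> nnorm (dual W) h * nnorm W (L x)"
        using W.dual_norm_upper[OF h Lmem[OF x]] .
      also have "\<dots> \<le> nnorm (dual W) h * (M * nnorm Z x)"
        by (intro mult_left_mono Lnorm x W'.nonneg h)
      finally show ?thesis using x by (simp add: ac_simps)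
    qed
    show ?thesis
    proof
      show "adjoint Z L h \<in> vectors (dual Z)"
        by (rule Z.dualI[OF _ _ b])
          (use h in \<open>simp_all add: Ladd Lscale Lmem dual_add dual_scale, simp add: adjoint_def\<close>)
      show "nnorm (dual Z) (adjoint Z L h) \<le> M * nnorm (dual W) h"
        using b M W'.nonneg[OF h] by (intro Z.dual_norm_le) auto
    qed
  qed
  then show ?thesis by (auto simp: bounded_operator_def adjoint_def fun_eq_iff)
qed

text \<open>
  The third adjoint of \<open>L\<close> sends functionals that norm \<open>L x\<close> to functionals that norm \<open>x\<close>, hence identifies
  any two of them. It is injective because the second adjoint of \<open>R\<close> is a right inverse of the
  second adjoint of \<open>L\<close>.
\<close>
lemma very_smooth_point_image:
  assumes Z: "seminormed_nspace Z" and W: "seminormed_nspace W"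
    and L: "bounded_operator Z W 1 L" and R: "bounded_operator W Z 1 R"
    and LR: "\<And>w. w \<in> vectors W \<Longrightarrow> L (R w) = w"
    and x: "very_smooth_point Z x" and norm: "nnorm W (L x) = 1"
  shows "very_smooth_point W (L x)"
proof -
  interpret Z: seminormed_nspace Z by (rule Z)
  interpret Z': seminormed_nspace "dual Z" by (rule Z.seminormed_dual)
  interpret W: seminormed_nspace W by (rule W)
  interpret W': seminormed_nspace "dual W" by (rule W.seminormed_dual)
  define L' where "L' = adjoint Z L"
  define L'' where "L'' = adjoint (dual W) L'"
  define L''' where "L''' = adjoint (dual (dual Z)) L''"
  define R' where "R' = adjoint W R"
  define R'' where "R'' = adjoint (dual Z) R'"
  have L': "bounded_operator (dual W) (dual Z) 1 L'"
    unfolding L'_def by (intro bounded_operator_adjoint Z W L) simp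
  have L'': "bounded_operator (dual (dual Z)) (dual (dual W)) 1 L''"
    unfolding L''_def
    by (intro bounded_operator_adjoint Z.seminormed_dual W.seminormed_dual L') simp
  have L''': "bounded_operator (dual (dual (dual W))) (dual (dual (dual Z))) 1 L'''"
    unfolding L'''_def
    by (intro bounded_operator_adjoint Z'.seminormed_dual W'.seminormed_dual L'') simp
  have R': "bounded_operator (dual Z) (dual W) 1 R'"
    unfolding R'_def by (intro bounded_operator_adjoint Z W R) simp
  have R'': "bounded_operator (dual (dual W)) (dual (dual Z)) 1 R''"
    unfolding R''_def
    by (intro bounded_operator_adjoint Z.seminormed_dual W.seminormed_dual R') simp
  note opsimps = bounded_operator_def
  have xZ: "x \<in> vectors Z" using Z.very_smooth_mem[OF x] .
  have Lx: "L x \<in> vectors W" using L xZ by (auto simp: opsimps)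
  have R'L': "R' (L' h) = h" if h: "h \<in> vectors (dual W)" for h
  proof
    fix w
    show "R' (L' h) w = h w"
      using LR R h by (cases "w \<in> vectors W") (auto simp: R'_def L'_def opsimps adjoint_def dual_outside)
  qed
  have L''R'': "L'' (R'' H) = H" if H: "H \<in> vectors (dual (dual W))" for H
  proof
    fix h
    show "L'' (R'' H) h = H h"
      using R'L' L' H
      by (cases "h \<in> vectors (dual W)") (auto simp: R''_def L''_def opsimps adjoint_def dual_outside)
  qed
  have natural: "L'' (canonical_embedding Z x) = canonical_embedding W (L x)"
    using L' xZ by (auto simp: L''_def L'_def adjoint_def opsimps canonical_embedding_def)
  show ?thesis
  proof (rule W.very_smooth_pointI[OF Lx norm])
    fix F F' assume F: "F \<in> vectors (dual (dual (dual W)))" "nnorm (dual (dual (dual W))) F \<le> 1"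
        "F (canonical_embedding W (L x)) = 1"
      and F': "F' \<in> vectors (dual (dual (dual W)))" "nnorm (dual (dual (dual W))) F' \<le> 1"
        "F' (canonical_embedding W (L x)) = 1"
    have props: "L''' E \<in> vectors (dual (dual (dual Z)))" "nnorm (dual (dual (dual Z))) (L''' E) \<le> 1"
      "L''' E (canonical_embedding Z x) = 1"
      if E: "E \<in> vectors (dual (dual (dual W)))" "nnorm (dual (dual (dual W))) E \<le> 1"
        "E (canonical_embedding W (L x)) = 1" for E
    proof -
      have "L''' E \<in> vectors (dual (dual (dual Z))) \<and>
          nnorm (dual (dual (dual Z))) (L''' E) \<le> 1 * nnorm (dual (dual (dual W))) E"
        using L''' E(1) unfolding opsimps by blast
      then show "L''' E \<in> vectors (dual (dual (dual Z)))" "nnorm (dual (dual (dual Z))) (L''' E) \<le> 1"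
        using E(2) by auto
      show "L''' E (canonical_embedding Z x) = 1"
        using E(3) xZ by (simp add: L'''_def Z.canonical_embedding_mem natural)
    qed
    have eq: "L''' F = L''' F'"
      using Z.very_smooth_unique[OF x props[OF F] props[OF F']] .
    show "F = F'"
    proof
      fix H show "F H = F' H"
      proof (cases "H \<in> vectors (dual (dual W))")
        case True
        then have "R'' H \<in> vectors (dual (dual Z))" using R'' unfolding opsimps by blast
        then show ?thesis using fun_cong[OF eq, of "R'' H"] True by (simp add: L'''_def L''R'')
      next
        case False
        then show ?thesis using F(1) F'(1) by (simp add: dual_outside)
      qed
    qed
  qed
qed

section \<open>The space of compact operators\<close>

lemma vectors_whole_space [simp]: "vectors (whole_space s) = UNIV"
  and smul_whole_space [simp]: "smul (whole_space s) = s"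
  and nnorm_whole_space [simp]: "nnorm (whole_space s) = norm"
  by (simp_all add: whole_space_def)

context normed_space_over
begin

lemma scale_scaleR: "scale c (r *\<^sub>R x) = r *\<^sub>R scale c x"
  by (metis scale_left_commute scale_of_real)

lemma bounded_linear_scale: "bounded_linear (scale c)"
  by (rule bounded_linear_intro[of _ "norm c"])
    (simp_all add: scale_right_distrib scale_scaleR norm_scale)

lemma bounded_linear_scale_left: "bounded_linear (\<lambda>c. scale c x)"
proof (rule bounded_linear_intro[of _ "norm x"])
  show "scale (r *\<^sub>R c) x = r *\<^sub>R scale c x" for r c
    by (metis scaleR_conv_of_real scale_of_real scale_scale)
qed (simp_all add: scale_left_distrib norm_scale)

lemma seminormed_whole_space: "seminormed_nspace (whole_space scale)"
  by unfold_locales (auto simp: norm_triangle_ineq norm_scale scale_right_distrib scale_left_distrib)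

end

locale operator_pair = X: normed_space_over sX + Y: normed_space_over sY
  for sX :: "'k::{real_normed_field,euclidean_space} \<Rightarrow> 'a::banach \<Rightarrow> 'a"
    and sY :: "'k \<Rightarrow> 'b::real_normed_vector \<Rightarrow> 'b"
begin

sublocale BX: seminormed_nspace "whole_space sX" by (rule X.seminormed_whole_space)
sublocale BY: seminormed_nspace "whole_space sY" by (rule Y.seminormed_whole_space)

abbreviation "K \<equiv> compact_operators sX sY"

lemma vectors_K: "T \<in> vectors K \<longleftrightarrow> Vector_Spaces.linear sX sY T \<and> compact (closure (T ` cball 0 1))"
  and smul_K [simp]: "smul K = (\<lambda>c T x. sY c (T x))"
  and nnorm_K [simp]: "nnorm K = onorm"
  by (simp_all add: compact_operators_def)

lemma
  assumes "T \<in> vectors K"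
  shows K_add: "T (x + y) = T x + T y" and K_scale: "T (sX c x) = sY c (T x)"
    and K_compact: "compact (closure (T ` cball 0 1))"
  using assms module_hom.add[of sX sY T] module_hom.scale[of sX sY T]
  by (simp_all add: vectors_K module_hom_iff_linear)

lemma linear_criterion:
  assumes "\<And>x y. T (x + y) = T x + T y" "\<And>c x. T (sX c x) = sY c (T x)"
  shows "Vector_Spaces.linear sX sY T"
  using assms by (intro Vector_Spaces.linear_iff[THEN iffD2])
    (auto intro: X.vector_space_axioms Y.vector_space_axioms)

lemma K_I:
  assumes "\<And>x y. T (x + y) = T x + T y" "\<And>c x. T (sX c x) = sY c (T x)"
    and "compact C" "\<And>x. norm x \<le> 1 \<Longrightarrow> T x \<in> C"
  shows "T \<in> vectors K"
  unfolding vectors_K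
proof
  have "closure (T ` cball 0 1) \<subseteq> C"
    using assms by (intro closure_minimal compact_imp_closed) auto
  then have "closure (T ` cball 0 1) = C \<inter> closure (T ` cball 0 1)" by blast
  then show "compact (closure (T ` cball 0 1))"
    using compact_Int_closed[OF assms(3) closed_closure] by metis
qed (use assms in \<open>auto intro: linear_criterion\<close>)

lemma bound_from_ball:
  assumes scale: "\<And>r x. T (r *\<^sub>R x) = r *\<^sub>R T x" and B: "\<And>x. norm x \<le> 1 \<Longrightarrow> norm (T x) \<le> B"
  shows "norm (T x) \<le> B * norm x"
proof (cases "x = 0")
  case True
  then show ?thesis using scale[of 0 0] by simp
next
  case False
  then show ?thesis using B[of "(1 / norm x) *\<^sub>R x"] by (simp add: scale field_simps)
qed

lemma K_scaleR: "T \<in> vectors K \<Longrightarrow> T (r *\<^sub>R x) = r *\<^sub>R T x"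
  using K_scale[of T "of_real r" x] by (simp add: X.scale_of_real Y.scale_of_real)

lemma K_bounded_linear:
  assumes T: "T \<in> vectors K" shows "bounded_linear T"
proof -
  obtain B where B: "\<And>y. y \<in> closure (T ` cball 0 1) \<Longrightarrow> norm y \<le> B"
    using compact_imp_bounded[OF K_compact[OF T]] by (auto simp: bounded_iff)
  have "norm (T x) \<le> B" if "norm x \<le> 1" for x
    using that closure_subset[of "T ` cball 0 1"] by (intro B) auto
  then have "norm (T x) \<le> norm x * B" for x
    using bound_from_ball[of T B x] K_scaleR[OF T] by (simp add: mult.commute)
  then show ?thesis
    by (intro bounded_linear_intro[of T B] K_add K_scaleR T)
qed

lemma K_subspace: "linear_subspace (smul K) (vectors K)"
proof -
  interpret F: vector_space "smul K"
    unfolding smul_K by (rule vector_space_pointwise) (rule Y.vector_space_axioms)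
  have "F.subspace (vectors K)"
  proof (rule F.subspaceI)
    show "0 \<in> vectors K" by (rule K_I[of _ "{0}"]) auto
  next
    fix S T assume S: "S \<in> vectors K" and T: "T \<in> vectors K"
    show "S + T \<in> vectors K"
    proof (rule K_I)
      show "compact {a + b |a b. a \<in> closure (S ` cball 0 1) \<and> b \<in> closure (T ` cball 0 1)}"
        using K_compact[OF S] K_compact[OF T] by (rule compact_sums)
      show "(S + T) x \<in> {a + b |a b. a \<in> closure (S ` cball 0 1) \<and> b \<in> closure (T ` cball 0 1)}"
        if "norm x \<le> 1" for x
      proof -
        have "S x \<in> closure (S ` cball 0 1)" "T x \<in> closure (T ` cball 0 1)"
          using that by (auto intro!: closure_subset[THEN subsetD])
        then show ?thesis by auto
      qed
    qed (simp_all add: K_add[OF S] K_add[OF T] K_scale[OF S] K_scale[OF T] Y.scale_right_distrib)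
  next
    fix c T assume T: "T \<in> vectors K"
    have "(\<lambda>x. sY c (T x)) \<in> vectors K"
    proof (rule K_I)
      show "compact (sY c ` closure (T ` cball 0 1))"
        using K_compact[OF T] Y.bounded_linear_scale
        by (intro compact_continuous_image linear_continuous_on)
      show "sY c (T x) \<in> sY c ` closure (T ` cball 0 1)" if "norm x \<le> 1" for x
        using that by (auto intro!: imageI closure_subset[THEN subsetD])
    qed (simp_all add: K_add[OF T] K_scale[OF T] Y.scale_right_distrib mult.commute)
    then show "smul K c T \<in> vectors K" by simp
  qed
  then show ?thesis by unfold_locales
qed

lemma norm_le_onorm: "T \<in> vectors K \<Longrightarrow> norm (T x) \<le> onorm T * norm x"
  by (rule onorm[OF K_bounded_linear])

lemma onorm_nonneg: "T \<in> vectors K \<Longrightarrow> 0 \<le> onorm T"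
  by (rule onorm_pos_le[OF K_bounded_linear])

sublocale K: seminormed_nspace K
  unfolding seminormed_nspace_def
proof (rule seminorm_onI[OF K_subspace])
  fix S T assume "S \<in> vectors K" "T \<in> vectors K"
  then show "nnorm K (S + T) \<le> nnorm K S + nnorm K T"
    using onorm_triangle[of S T] by (simp add: K_bounded_linear plus_fun_def)
next
  fix c T assume T: "T \<in> vectors K"
  have "onorm (\<lambda>x. sY c (T x)) \<le> norm c * onorm T"
    by (rule onorm_bound)
      (use onorm_nonneg[OF T] norm_le_onorm[OF T] in \<open>simp_all add: Y.norm_scale mult.assoc mult_left_mono\<close>)
  then show "nnorm K (smul K c T) \<le> norm c * nnorm K T" by simp
qed

lemma bounded_operator_evaluation: "bounded_operator K (whole_space sY) (norm x) (\<lambda>T. T x)"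
  using norm_le_onorm[of _ x] by (simp add: bounded_operator_def mult.commute)

text \<open>
  The image of the unit ball lies in the image of a ball of scalars, which is compact since the
  scalar field is finite-dimensional.
\<close>
lemma bounded_operator_rank_one:
  assumes f: "f \<in> vectors (dual (whole_space sX))"
  shows "bounded_operator (whole_space sY) K (nnorm (dual (whole_space sX)) f) (\<lambda>y x. sY (f x) y)"
proof -
  let ?N = "nnorm (dual (whole_space sX)) f"
  interpret X': seminormed_nspace "dual (whole_space sX)" by (rule BX.seminormed_dual)
  have N: "norm (f x) \<le> ?N * norm x" for x using BX.dual_norm_upper[OF f] by simp
  have N0: "0 \<le> ?N" using X'.nonneg[OF f] .
  have "(\<lambda>x. sY (f x) y) \<in> vectors K" for y
  proof (rule K_I)
    show "compact ((\<lambda>c. sY c y) ` cball 0 ?N)"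
      by (intro compact_continuous_image linear_continuous_on Y.bounded_linear_scale_left) simp
    show "sY (f x) y \<in> (\<lambda>c. sY c y) ` cball 0 ?N" if "norm x \<le> 1" for x
      using N[of x] that mult_left_mono[OF that N0] by auto
  qed (use dual_add[OF f] dual_scale[OF f] in \<open>simp_all add: Y.scale_left_distrib\<close>)
  moreover have "onorm (\<lambda>x. sY (f x) y) \<le> ?N * norm y" for y
    by (rule onorm_bound)
      (use N N0 mult_right_mono[OF N, of "norm y"] in \<open>simp_all add: Y.norm_scale ac_simps\<close>)
  ultimately show ?thesis
    by (auto simp: bounded_operator_def fun_eq_iff Y.scale_right_distrib mult.commute)
qed

text \<open>
  The functional \<open>x \<otimes> g\<close> on the compact operators. It is the value at \<open>g\<close> of the adjoint of evaluation
  at \<open>x\<close>, and so inherits boundedness from \<open>bounded_operator_adjoint\<close>.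
\<close>
abbreviation point_functional :: "'a \<Rightarrow> ('b \<Rightarrow> 'k) \<Rightarrow> ('a \<Rightarrow> 'b) \<Rightarrow> 'k" where
  "point_functional x \<equiv> adjoint K (\<lambda>T. T x)"

lemma
  assumes g: "g \<in> vectors (dual (whole_space sY))"
  shows point_functional_mem: "point_functional x g \<in> vectors (dual K)"
    and point_functional_norm: "nnorm (dual K) (point_functional x g) \<le> norm x * nnorm (dual (whole_space sY)) g"
  using bounded_operator_adjoint[OF K.seminormed_nspace_axioms BY.seminormed_nspace_axioms
      bounded_operator_evaluation norm_ge_zero, of x] g
  by (auto simp: bounded_operator_def)

lemma point_functional_add:
  assumes g: "g \<in> vectors (dual (whole_space sY))"
  shows "point_functional (x + y) g = point_functional x g + point_functional y g"
  by (rule ext) (simp add: adjoint_def K_add dual_add[OF g])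

lemma point_functional_scale:
  assumes g: "g \<in> vectors (dual (whole_space sY))"
  shows "point_functional (sX c x) g = (\<lambda>T. c * point_functional x g T)"
  using dual_scale[OF g] by (intro ext) (simp add: adjoint_def K_scale)

lemma point_functional_diff:
  assumes g: "g \<in> vectors (dual (whole_space sY))"
  shows "point_functional (x - y) g = point_functional x g - point_functional y g"
  using point_functional_add[OF g, of "x - y" y] by (simp add: algebra_simps)

lemma dual_apply_scale: "g \<in> vectors (dual (whole_space sY)) \<Longrightarrow> g (sY c y) = c * g y"
  using dual_scale[of g "whole_space sY" y c] by simp

text \<open>
  Testing \<open>x \<otimes> g\<close> on the rank one operator \<open>u \<mapsto> f u \<cdot> y\<close>, with \<open>f\<close> norming \<open>x\<close>, recovers the norm
  of \<open>x\<close>.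
\<close>
lemma norm_le_point_functional:
  assumes g: "g \<in> vectors (dual (whole_space sY))" and y: "norm y \<le> 1" "g y = 1"
  shows "norm x \<le> nnorm (dual K) (point_functional x g)"
proof -
  interpret K': seminormed_nspace "dual K" by (rule K.seminormed_dual)
  obtain f where f: "f \<in> vectors (dual (whole_space sX))" "nnorm (dual (whole_space sX)) f \<le> 1"
    "f x = of_real (norm x)"
    using BX.norming_functional[of x] by auto
  let ?S = "\<lambda>u. sY (f u) y"
  have S: "?S \<in> vectors K" "onorm ?S \<le> nnorm (dual (whole_space sX)) f * norm y"
    using bounded_operator_rank_one[OF f(1)] by (auto simp: bounded_operator_def)
  have "nnorm (dual (whole_space sX)) f * norm y \<le> 1"
    using f(2) y(1) by (intro mult_le_one) auto
  with S(2) have S1: "onorm ?S \<le> 1" by simp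
  have "point_functional x g ?S = of_real (norm x)"
    using S(1) f(3) y(2) by (simp add: dual_apply_scale[OF g])
  then have "norm x \<le> nnorm (dual K) (point_functional x g) * onorm ?S"
    using K.dual_norm_upper[OF point_functional_mem[OF g] S(1), of x] by simp
  also have "\<dots> \<le> nnorm (dual K) (point_functional x g)"
    using S1 K'.nonneg[OF point_functional_mem[OF g]] by (intro mult_left_le)
  finally show ?thesis .
qed

lemma point_functionals_subspace:
  assumes g: "g \<in> vectors (dual (whole_space sY))"
  shows "linear_subspace (smul (dual K)) (range (\<lambda>x. point_functional x g))"
proof -
  interpret K': seminormed_nspace "dual K" by (rule K.seminormed_dual)
  have "K'.subspace (range (\<lambda>x. point_functional x g))"
  proof (rule K'.subspaceI)
    have "point_functional 0 g = 0" using point_functional_diff[OF g, of 0 0] by simp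
    then show "0 \<in> range (\<lambda>x. point_functional x g)" by (metis rangeI)
  qed (auto simp: point_functional_add[OF g, symmetric] point_functional_scale[OF g, symmetric])
  then show ?thesis by unfold_locales
qed

text \<open>
  The map \<open>x \<mapsto> x \<otimes> g\<close> is linear and does not decrease norms, so preimages of a convergent sequence
  are Cauchy; completeness of the domain of the operators provides the limit.
\<close>
lemma point_functionals_closed:
  assumes g: "g \<in> vectors (dual (whole_space sY))" and y: "norm y \<le> 1" "g y = 1"
    and z: "z \<in> vectors (dual K)"
    and approx: "\<And>\<epsilon>. \<epsilon> > 0 \<Longrightarrow> \<exists>d\<in>range (\<lambda>x. point_functional x g). nnorm (dual K) (z - d) < \<epsilon>"
  shows "\<exists>x. z = point_functional x g"
proof -
  interpret K': seminormed_nspace "dual K" by (rule K.seminormed_dual)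
  have pf: "point_functional x g \<in> vectors (dual K)" for x by (rule point_functional_mem[OF g])
  have "\<exists>x. nnorm (dual K) (z - point_functional x g) < inverse (Suc n)" for n
    using approx[of "inverse (Suc n)"] by auto
  then obtain x where x: "\<And>n. nnorm (dual K) (z - point_functional (x n) g) < inverse (Suc n)"
    by metis
  have dist: "norm (x m - x n) \<le> inverse (Suc m) + inverse (Suc n)" for m n
  proof -
    have "norm (x m - x n) \<le> nnorm (dual K) (point_functional (x m - x n) g)"
      using norm_le_point_functional[OF g y] .
    also have "point_functional (x m - x n) g
        = (z - point_functional (x n) g) + - (z - point_functional (x m) g)"
      by (simp add: point_functional_diff[OF g])
    also have "nnorm (dual K) \<dots> \<le> nnorm (dual K) (z - point_functional (x n) g)
        + nnorm (dual K) (- (z - point_functional (x m) g))"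
      using z pf by (intro K'.triangle K'.minus_mem K'.diff_mem)
    also have "nnorm (dual K) (- (z - point_functional (x m) g)) = nnorm (dual K) (z - point_functional (x m) g)"
      using z pf by (intro K'.minus K'.diff_mem)
    finally show ?thesis using x[of m] x[of n] by linarith
  qed
  have "Cauchy x"
  proof (rule CauchyI)
    fix e :: real assume "e > 0"
    then obtain N where N: "inverse (Suc N) < e / 2" using reals_Archimedean[of "e / 2"] by auto
    show "\<exists>M. \<forall>m\<ge>M. \<forall>n\<ge>M. norm (x m - x n) < e"
    proof (intro exI allI impI)
      fix m n assume "m \<ge> N" "n \<ge> N"
      then have "inverse (Suc m) \<le> inverse (Suc N)" "inverse (Suc n) \<le> inverse (Suc N)"
        by (auto intro!: le_imp_inverse_le)
      then show "norm (x m - x n) < e" using dist[of m n] N by linarith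
    qed
  qed
  then obtain x0 where x0: "x \<longlonglongrightarrow> x0" using Cauchy_convergent convergent_def by blast
  let ?w = "z - point_functional x0 g"
  have w: "?w \<in> vectors (dual K)" using z pf by (intro K'.diff_mem)
  have "nnorm (dual K) ?w \<le> inverse (Suc n) + norm (x n - x0) * nnorm (dual (whole_space sY)) g" for n
  proof -
    have "?w = (z - point_functional (x n) g) + point_functional (x n - x0) g"
      by (simp add: point_functional_diff[OF g])
    then have "nnorm (dual K) ?w \<le> nnorm (dual K) (z - point_functional (x n) g)
        + nnorm (dual K) (point_functional (x n - x0) g)"
      using K'.triangle[OF K'.diff_mem[OF z pf] pf] by metis
    then show ?thesis using x[of n] point_functional_norm[OF g, of "x n - x0"] by linarith
  qed
  moreover have "(\<lambda>n. inverse (Suc n) + norm (x n - x0) * nnorm (dual (whole_space sY)) g)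
      \<longlonglongrightarrow> 0 + norm (x0 - x0) * nnorm (dual (whole_space sY)) g"
    by (intro tendsto_intros x0 LIMSEQ_inverse_real_of_nat)
  ultimately have "nnorm (dual K) ?w \<le> 0"
    by (intro LIMSEQ_le_const) auto
  then have w0: "nnorm (dual K) ?w = 0" using K'.nonneg[OF w] by simp
  have "z = point_functional x0 g"
  proof
    fix S show "z S = point_functional x0 g S"
    proof (cases "S \<in> vectors K")
      case True
      then show ?thesis using K.dual_norm_upper[OF w True] w0 by simp
    next
      case False
      then show ?thesis using z by (simp add: dual_outside adjoint_def)
    qed
  qed
  then show ?thesis ..
qed

text \<open>
  By compactness the norm is attained on the closure of the image of the unit ball, though perhaps
  not on the image itself. A functional that norms the vector \<open>y\<close> found there detects the norm of \<open>T\<close>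
  along the image of the unit ball.
\<close>
lemma compact_norming_functional:
  assumes T: "T \<in> vectors K" "onorm T = 1"
  obtains g y where "g \<in> vectors (dual (whole_space sY))" "nnorm (dual (whole_space sY)) g \<le> 1"
    "norm y = 1" "g y = 1" "\<And>r. r < 1 \<Longrightarrow> \<exists>x. norm x \<le> 1 \<and> r < norm (g (T x))"
proof -
  let ?C = "closure (T ` cball 0 1)"
  have inC: "T x \<in> ?C" if "norm x \<le> 1" for x
    using that closure_subset[of "T ` cball 0 1"] by auto
  have "T 0 \<in> ?C" by (rule inC) simp
  then obtain y where y: "y \<in> ?C" "\<And>u. u \<in> ?C \<Longrightarrow> norm u \<le> norm y"
    using continuous_attains_sup[OF K_compact[OF T(1)], of norm] by (auto intro: continuous_intros)
  have "norm (T x) \<le> norm y * norm x" for x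
    using y(2) inC by (intro bound_from_ball K_scaleR T(1)) auto
  then have "1 \<le> norm y" using onorm_bound[of "norm y" T] T(2) by simp
  moreover have "?C \<subseteq> cball 0 1"
  proof (rule closure_minimal)
    show "T ` cball 0 1 \<subseteq> cball 0 1" 
      using norm_le_onorm[OF T(1)] T(2) by (force intro: order_trans)
  qed simp
  ultimately have norm_y: "norm y = 1" using y(1) by force
  obtain g where g: "g \<in> vectors (dual (whole_space sY))" "nnorm (dual (whole_space sY)) g \<le> 1"
    "g y = of_real (norm y)"
    using BY.norming_functional[of y] by auto
  have gb: "norm (g u) \<le> norm u" for u
    using BY.dual_norm_upper[OF g(1), of u] mult_right_mono[OF g(2), of "norm u"] by simp
  have "\<exists>x. norm x \<le> 1 \<and> r < norm (g (T x))" if "r < 1" for r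
  proof -
    obtain x where x: "norm x \<le> 1" "dist (T x) y < 1 - r"
      using y(1) \<open>r < 1\<close> closure_approachable[of y "T ` cball 0 1"] by (metis diff_gt_0_iff_gt imageE mem_cball_0)
    have "g y = g (T x) + g (y - T x)" using dual_add[OF g(1), of "T x" "y - T x"] by simp
    then have "1 \<le> norm (g (T x)) + norm (g (y - T x))"
      using g(3) norm_y by (metis norm_of_real norm_triangle_ineq abs_one)
    then have "r < norm (g (T x))"
      using gb[of "y - T x"] x(2) by (simp add: dist_norm norm_minus_commute)
    with x(1) show ?thesis by blast
  qed
  then show ?thesis using that[of g y] g norm_y by simp
qed

lemma norm_attaining_functional:
  assumes T: "T \<in> vectors K" "onorm T = 1" and x: "norm x = 1" "norm (T x) = 1"
  obtains g where "g \<in> vectors (dual (whole_space sY))" "point_functional x g \<in> vectors (dual K)"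
    "nnorm (dual K) (point_functional x g) \<le> 1" "point_functional x g T = 1"
proof -
  obtain g where g: "g \<in> vectors (dual (whole_space sY))" "nnorm (dual (whole_space sY)) g \<le> 1"
    "g (T x) = of_real (norm (T x))"
    using BY.norming_functional[of "T x"] by auto
  show ?thesis
    using that[of g] g point_functional_mem[OF g(1)] point_functional_norm[OF g(1), of x] T x by simp
qed

text \<open>
  Applied to the operators \<open>u \<mapsto> f u \<cdot> y\<close>, the equation gives \<open>f x = h y \<cdot> f x'\<close> for every \<open>f\<close>, and
  functionals separate points.
\<close>
lemma point_functional_eq_imp_proportional:
  assumes g: "g \<in> vectors (dual (whole_space sY))" and h: "h \<in> vectors (dual (whole_space sY))"
    and eq: "point_functional x g = point_functional x' h" and y: "g y = 1"
  shows "x = sX (h y) x'"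
proof -
  obtain f where f: "f \<in> vectors (dual (whole_space sX))"
    "f (x - sX (h y) x') = of_real (norm (x - sX (h y) x'))"
    using BX.norming_functional[of "x - sX (h y) x'"] by auto
  let ?S = "\<lambda>u. sY (f u) y"
  have S: "?S \<in> vectors K"
    using bounded_operator_rank_one[OF f(1)] by (auto simp: bounded_operator_def)
  have "f x = h y * f x'"
    using fun_cong[OF eq, of ?S] S y by (simp add: dual_apply_scale g h mult.commute)
  moreover have "f x = f (x - sX (h y) x') + h y * f x'"
    using dual_add[OF f(1), of "x - sX (h y) x'" "sX (h y) x'"] dual_scale[OF f(1), of x' "h y"] by simp
  ultimately have "of_real (norm (x - sX (h y) x')) = (0 :: 'k)" using f(2) by simp
  then show ?thesis by simp
qed

section \<open>Very smooth compact operators\<close>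

theorem very_smooth_compact_operator:
  assumes smooth: "very_smooth_point K T"
  shows "\<exists>x0. attains_norm_at T x0 \<and>
           (\<forall>x. attains_norm_at T x \<longrightarrow> (\<exists>c. x = sX c x0)) \<and>
           very_smooth_point (whole_space sY) (T x0)"
proof -
  have T: "T \<in> vectors K" "onorm T = 1"
    using K.very_smooth_mem[OF smooth] K.very_smooth_norm[OF smooth] by auto
  obtain g y where g: "g \<in> vectors (dual (whole_space sY))" "nnorm (dual (whole_space sY)) g \<le> 1"
    and y: "norm y = 1" "g y = 1"
    and norming: "\<And>r. r < 1 \<Longrightarrow> \<exists>x. norm x \<le> 1 \<and> r < norm (g (T x))"
    using compact_norming_functional[OF T] by blast
  \<comment> \<open>\<open>z\<close> will turn out to be the point functional of \<open>x0\<close> and \<open>g\<close>.\<close>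
  obtain z where z: "z \<in> vectors (dual K)" "nnorm (dual K) z \<le> 1" "z T = 1"
    using K.norming_functional[OF T(1)] T(2) by auto
  have "\<exists>d\<in>range (\<lambda>x. point_functional x g). nnorm (dual K) (z - d) < \<epsilon>" if "\<epsilon> > 0" for \<epsilon>
  proof (rule K.norming_functional_in_closure[OF smooth point_functionals_subspace[OF g(1)] _ _ z that])
    show "range (\<lambda>x. point_functional x g) \<subseteq> vectors (dual K)"
      using point_functional_mem[OF g(1)] by auto
    fix r :: real assume "r < 1"
    then obtain x where x: "norm x \<le> 1" "r < norm (g (T x))" using norming by blast
    have "norm x * nnorm (dual (whole_space sY)) g \<le> 1"
      using x(1) g(2) seminorm_on.nonneg[OF _ g(1)] BY.seminormed_dual
      by (intro mult_le_one) (auto simp: seminormed_nspace_def)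
    then have "nnorm (dual K) (point_functional x g) \<le> 1"
      using point_functional_norm[OF g(1), of x] by simp
    then show "\<exists>d\<in>range (\<lambda>x. point_functional x g). nnorm (dual K) d \<le> 1 \<and> r < norm (d T)"
      using x(2) T(1) by (intro bexI[of _ "point_functional x g"]) auto
  qed
  then obtain x0 where x0: "z = point_functional x0 g"
    using point_functionals_closed[OF g(1) _ y(2) z(1)] y(1) by auto
  have "norm x0 \<le> 1"
    using norm_le_point_functional[OF g(1) _ y(2), of x0] y(1) z(2) x0 by simp
  have "g (T x0) = 1" using z(3) x0 T(1) by simp
  then have "1 \<le> norm (T x0)"
    using BY.dual_norm_upper[OF g(1), of "T x0"] mult_right_mono[OF g(2), of "norm (T x0)"] by simp
  then have norms: "norm x0 = 1" "norm (T x0) = 1"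
    using norm_le_onorm[OF T(1), of x0] T(2) \<open>norm x0 \<le> 1\<close> by auto
  have unique: "\<exists>c. x = sX c x0" if att: "attains_norm_at T x" for x
  proof -
    have "norm x = 1" "norm (T x) = 1" using att T by (auto simp: attains_norm_at_def)
    then obtain h where h: "h \<in> vectors (dual (whole_space sY))"
      "point_functional x h \<in> vectors (dual K)" "nnorm (dual K) (point_functional x h) \<le> 1"
      "point_functional x h T = 1"
      using norm_attaining_functional[OF T] by blast
    have "point_functional x0 g = point_functional x h"
      using K.very_smooth_smooth[OF smooth z h(2-4)] x0 by simp
    then have eq: "x0 = sX (h y) x"
      by (rule point_functional_eq_imp_proportional[OF g(1) h(1) _ y(2)])
    have "h y \<noteq> 0" using eq norms(1) by auto
    then have "x = sX (inverse (h y)) x0" by (subst eq) simp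
    then show ?thesis ..
  qed
  \<comment> \<open>The operators \<open>x \<mapsto> f x \<cdot> u\<close> form the contractive right inverse of evaluation at \<open>x0\<close>.\<close>
  obtain f where f: "f \<in> vectors (dual (whole_space sX))" "nnorm (dual (whole_space sX)) f \<le> 1" "f x0 = 1"
    using BX.norming_functional[of x0] norms(1) by auto
  have "very_smooth_point (whole_space sY) (T x0)"
  proof (rule very_smooth_point_image[where L = "\<lambda>S. S x0" and R = "\<lambda>u x. sY (f x) u",
        OF K.seminormed_nspace_axioms BY.seminormed_nspace_axioms _ _ _ smooth])
    show "bounded_operator K (whole_space sY) 1 (\<lambda>S. S x0)"
      using bounded_operator_evaluation[of x0] norms(1) by simp
    have "nnorm (dual (whole_space sX)) f = 1"
      using f norms(1) by (intro BX.dual_norm_eq_1[of f x0]) auto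
    then show "bounded_operator (whole_space sY) K 1 (\<lambda>u x. sY (f x) u)"
      using bounded_operator_rank_one[OF f(1)] by simp
  qed (use f(3) norms(2) in simp_all)
  then show ?thesis using norms T unique by (auto simp: attains_norm_at_def)
qed

end

theorem corollary14:
  fixes sX :: "'k::{real_normed_field,euclidean_space} \<Rightarrow> 'a::banach \<Rightarrow> 'a"
    and sY :: "'k \<Rightarrow> 'b::banach \<Rightarrow> 'b"
    and T :: "'a \<Rightarrow> 'b"
  assumes "normed_space_over sX"
    and "normed_space_over sY"
    and "very_smooth_point (compact_operators sX sY) T"
  shows "\<exists>x0. attains_norm_at T x0 \<and>
           (\<forall>x. attains_norm_at T x \<longrightarrow> (\<exists>c. x = sX c x0)) \<and>
           very_smooth_point (whole_space sY) (T x0)"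
proof -
  interpret operator_pair sX sY
    using assms(1,2) by (simp add: operator_pair_def)
  show ?thesis using assms(3) by (rule very_smooth_compact_operator)
qed

end
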